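(* Let $r\ge2$ and let $G$ be a group with center $Z(G)$. If $\omega(x_1,\ldots,x_r)=a\,x_1\cdots x_r$ with $a\in G\setminus Z(G)$ and $aZ(G)$ has finite order $k$ in $G/Z(G)$, then $\partial_r(\mathrm{Assoc}_r(\omega))=k\mathbb Z\times\mathbb Z$. If $\omega(x_1,\ldots,x_r)=x_1\cdots x_r\,b$ with $b\in G\setminus Z(G)$ and $bZ(G)$ has finite order $k$ in $G/Z(G)$, then $\partial_r(\mathrm{Assoc}_r(\omega))=\mathbb Z\times k\mathbb Z$. If $\omega(x_1,\ldots,x_r)=d\,\psi(x_1\cdots x_r)$ with $d\in Z(G)$ and $\mathrm{id}\neq\psi\in\mathrm{Aut}(G)$ of finite order $h$, then $\partial_r(\mathrm{Assoc}_r(\omega))=h\mathbb Z\times h\mathbb Z$. Thus the image $\partial_r(\mathrm{Assoc}_r(\omega))\subseteq\mathbb Z^2$ distinguishes these three cases and recovers the finite order ($k$ or $h$).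
   Context: A full ordered $r$-ary tree is either a single leaf or a root with an ordered $r$-tuple of full ordered $r$-ary subtrees. For an operation $q\colon Q^r\to Q$ and such a tree $T$ with $n$ leaves, $q_T\colon Q^n\to Q$ is obtained by placing the variables at the leaves from left to right and applying $q$ at every internal vertex. Higman–Thompson group $F_r$: its elements are represented by pairs $(T,U)$ of full ordered $r$-ary trees with the same number of leaves, modulo the equivalence relation generated by simultaneous expansion, i.e. replacing the $i$th leaf of both $T$ and $U$ by a caret (an internal vertex with $r$ leaf children). To compose $(T,U)$ with $(U',V)$, expand both pairs simultaneously until the middle trees become the same tree and take the pair of outer trees; the identity is represented by $(T,T)$ and the inverse of $(T,U)$ by $(U,T)$. $\mathrm{Assoc}_r(q)\le F_r$ is the subgroup of elements having a representative $(T,U)$ with $q_T=q_U$. In the piecewise-linear model, the leaves of a full ordered $r$-ary tree give a subdivision of $[0,1]$ into standard $r$-adic intervals (a leaf of depth $\delta$ gives an interval of length $r^{-\delta}$), and $(T,U)$ acts as the increasing homeomorphism of $[0,1]$ mapping the $i$th interval of $T$ affinely onto the $i$th interval of $U$, so with slope $r^{\delta_T(i)-\delta_U(i)}$. For $g\in F_r$ put $\partial_r(g)=(\log_r g'(0^+),\log_r g'(1^-))\in\mathbb Z^2$. *)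

theory Defs
  imports "HOL-Analysis.Analysis" "HOL-Algebra.Algebra"
begin

datatype tree = Leaf | Node "tree list"

fun full :: "nat \<Rightarrow> tree \<Rightarrow> bool" where
  "full r Leaf \<longleftrightarrow> True"
| "full r (Node ts) \<longleftrightarrow> length ts = r \<and> (\<forall>t\<in>set ts. full r t)"

fun leaves :: "tree \<Rightarrow> nat" where
  "leaves Leaf = 1"
| "leaves (Node ts) = sum_list (map leaves ts)"

definition tuples :: "nat \<Rightarrow> 'a set \<Rightarrow> 'a list set" where
  "tuples n Q = {xs. length xs = n \<and> set xs \<subseteq> Q}"

text \<open>An r-ary operation is a function on lists, of which only the values on
  \<open>tuples r Q\<close> matter. For a full r-ary tree \<open>T\<close>, the function \<open>eval q T\<close> on
  \<open>tuples (leaves T) Q\<close> is the operation \<open>q\<^sub>T\<close>.\<close>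

fun eval :: "('a list \<Rightarrow> 'a) \<Rightarrow> tree \<Rightarrow> 'a list \<Rightarrow> 'a"
  and eval_list :: "('a list \<Rightarrow> 'a) \<Rightarrow> tree list \<Rightarrow> 'a list \<Rightarrow> 'a list" where
  "eval q Leaf xs = hd xs"
| "eval q (Node ts) xs = q (eval_list q ts xs)"
| "eval_list q [] xs = []"
| "eval_list q (t # ts) xs =
     eval q t (take (leaves t) xs) # eval_list q ts (drop (leaves t) xs)"

text \<open>\<open>expand r i T\<close> replaces leaf number \<open>i\<close> (counted from 0, left to right) by a caret.\<close>

fun expand :: "nat \<Rightarrow> nat \<Rightarrow> tree \<Rightarrow> tree"
  and expand_list :: "nat \<Rightarrow> nat \<Rightarrow> tree list \<Rightarrow> tree list" where
  "expand r i Leaf = Node (replicate r Leaf)"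
| "expand r i (Node ts) = Node (expand_list r i ts)"
| "expand_list r i [] = []"
| "expand_list r i (t # ts) =
     (if i < leaves t then expand r i t # ts else t # expand_list r (i - leaves t) ts)"

definition tree_pairs :: "nat \<Rightarrow> (tree \<times> tree) set" where
  "tree_pairs r = {(T, U). full r T \<and> full r U \<and> leaves T = leaves U}"

definition expansion_step :: "nat \<Rightarrow> ((tree \<times> tree) \<times> (tree \<times> tree)) set" where
  "expansion_step r =
     {((T, U), (expand r i T, expand r i U)) | T U i. (T, U) \<in> tree_pairs r \<and> i < leaves T}"

definition expansion_equiv :: "nat \<Rightarrow> ((tree \<times> tree) \<times> (tree \<times> tree)) set" where
  "expansion_equiv r =
     {(p, p'). p \<in> tree_pairs r \<and> p' \<in> tree_pairs r \<and>
       (p, p') \<in> (expansion_step r \<union> (expansion_step r)\<inverse>)\<^sup>*}"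

lemma equiv_expansion_equiv: "equiv (tree_pairs r) (expansion_equiv r)"
proof (rule equivI)
  show "expansion_equiv r \<subseteq> tree_pairs r \<times> tree_pairs r"
    by (auto simp: expansion_equiv_def)
  show "refl_on (tree_pairs r) (expansion_equiv r)"
    by (auto simp: refl_on_def expansion_equiv_def)
  have "sym ((expansion_step r \<union> (expansion_step r)\<inverse>)\<^sup>*)"
    by (intro sym_rtrancl sym_Un_converse)
  then show "sym (expansion_equiv r)"
    by (auto simp: sym_def expansion_equiv_def)
  show "trans (expansion_equiv r)"
    by (auto simp: trans_def expansion_equiv_def intro: rtrancl_trans)
qed

text \<open>For classes \<open>x\<close> and \<open>y\<close>, the relation composition \<open>x O y\<close> consists of the pairs
  \<open>(T, V)\<close> such that \<open>(T, U) \<in> x\<close> and \<open>(U, V) \<in> y\<close> for a common middle tree \<open>U\<close>. It need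
  not be a full class (it may miss the reduced pairs), hence the saturation.\<close>

definition HT :: "nat \<Rightarrow> (tree \<times> tree) set monoid" where
  "HT r = \<lparr>carrier = tree_pairs r // expansion_equiv r,
           mult = (\<lambda>x y. expansion_equiv r `` (x O y)),
           one = expansion_equiv r `` {(Leaf, Leaf)}\<rparr>"

definition Assoc :: "nat \<Rightarrow> 'a set \<Rightarrow> ('a list \<Rightarrow> 'a) \<Rightarrow> (tree \<times> tree) set set" where
  "Assoc r Q q =
     {g \<in> carrier (HT r). \<exists>(T, U)\<in>g. \<forall>xs\<in>tuples (leaves T) Q. eval q T xs = eval q U xs}"

text \<open>\<open>intervals r a l T\<close> lists the leaf intervals of \<open>T\<close>, each as a pair of left endpoint
  and length, when the root carries the interval \<open>[a, a + l]\<close>. In \<open>intervals_list r a l ts\<close>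
  each tree of the forest \<open>ts\<close> gets an interval of length \<open>l\<close>, the first one starting at \<open>a\<close>.\<close>

fun intervals :: "nat \<Rightarrow> real \<Rightarrow> real \<Rightarrow> tree \<Rightarrow> (real \<times> real) list"
  and intervals_list :: "nat \<Rightarrow> real \<Rightarrow> real \<Rightarrow> tree list \<Rightarrow> (real \<times> real) list" where
  "intervals r a l Leaf = [(a, l)]"
| "intervals r a l (Node ts) = intervals_list r a (l / real r) ts"
| "intervals_list r a l [] = []"
| "intervals_list r a l (t # ts) = intervals r a l t @ intervals_list r (a + l) l ts"

fun affine_pieces :: "(real \<times> real) list \<Rightarrow> (real \<times> real) list \<Rightarrow> real \<Rightarrow> real" where
  "affine_pieces ((a, l) # I) ((b, m) # J) x =
     (if x \<le> a + l then b + (x - a) * (m / l) else affine_pieces I J x)"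
| "affine_pieces _ _ x = x"

definition pl_map :: "nat \<Rightarrow> tree \<times> tree \<Rightarrow> real \<Rightarrow> real" where
  "pl_map r = (\<lambda>(T, U). restrict (affine_pieces (intervals r 0 1 T) (intervals r 0 1 U)) {0..1})"

text \<open>All representatives of an element \<open>g\<close> of the group have the same \<open>pl_map\<close>, so that
  the image below is a singleton.\<close>

definition homeo :: "nat \<Rightarrow> (tree \<times> tree) set \<Rightarrow> real \<Rightarrow> real" where
  "homeo r g = the_elem (pl_map r ` g)"

definition bdry :: "nat \<Rightarrow> (tree \<times> tree) set \<Rightarrow> real \<times> real" where
  "bdry r g = (log (real r) (vector_derivative (homeo r g) (at_right 0)),
               log (real r) (vector_derivative (homeo r g) (at_left 1)))"

definition multiples :: "nat \<Rightarrow> real set" where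
  "multiples k = (\<lambda>m. real k * m) ` \<int>"

definition center :: "('a, 'm) monoid_scheme \<Rightarrow> 'a set" where
  "center G = {z \<in> carrier G. \<forall>g\<in>carrier G. z \<otimes>\<^bsub>G\<^esub> g = g \<otimes>\<^bsub>G\<^esub> z}"

definition list_prod :: "('a, 'm) monoid_scheme \<Rightarrow> 'a list \<Rightarrow> 'a" where
  "list_prod G xs = foldr (\<otimes>\<^bsub>G\<^esub>) xs \<one>\<^bsub>G\<^esub>"

text \<open>Orders in the sense of \<^const>\<open>group.ord\<close> are 0 for elements of infinite order, so
  \<open>k > 0\<close> expresses that the order is finite. The elements of \<^const>\<open>AutoGroup\<close> are the
  automorphisms, made extensional outside the carrier.\<close>

datatype op_kind = Left_Const | Right_Const | Twisted

fun op_of_kind ::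
  "op_kind \<Rightarrow> nat \<Rightarrow> ('a, 'm) monoid_scheme \<Rightarrow> nat \<Rightarrow> ('a list \<Rightarrow> 'a) \<Rightarrow> bool" where
  "op_of_kind Left_Const r G k \<omega> \<longleftrightarrow>
     (\<exists>a \<in> carrier G - center G.
        k > 0 \<and> group.ord (G Mod center G) (center G #>\<^bsub>G\<^esub> a) = k \<and>
        (\<forall>xs\<in>tuples r (carrier G). \<omega> xs = a \<otimes>\<^bsub>G\<^esub> list_prod G xs))"
| "op_of_kind Right_Const r G k \<omega> \<longleftrightarrow>
     (\<exists>b \<in> carrier G - center G.
        k > 0 \<and> group.ord (G Mod center G) (center G #>\<^bsub>G\<^esub> b) = k \<and>
        (\<forall>xs\<in>tuples r (carrier G). \<omega> xs = list_prod G xs \<otimes>\<^bsub>G\<^esub> b))"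
| "op_of_kind Twisted r G h \<omega> \<longleftrightarrow>
     (\<exists>d \<in> center G. \<exists>\<psi> \<in> carrier (AutoGroup G).
        \<psi> \<noteq> \<one>\<^bsub>AutoGroup G\<^esub> \<and> h > 0 \<and> group.ord (AutoGroup G) \<psi> = h \<and>
        (\<forall>xs\<in>tuples r (carrier G). \<omega> xs = d \<otimes>\<^bsub>G\<^esub> \<psi> (list_prod G xs)))"

end

theory Submission
  imports Defs
begin

text \<open>The boundary germ of the element represented by \<open>(T, U)\<close> only involves the outermost leaves:
  its slope at 0 is \<open>r\<close> to the leftmost leaf depth of \<open>T\<close> minus that of \<open>U\<close>, and the slope at 1
  is given by the rightmost depths in the same way (\<open>bdry_eq_depth_differences\<close>). The image of
  \<open>Assoc\<close> is therefore the set of depth differences of pairs of trees with equally many leaves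
  that induce the same operation (\<open>bdry_Assoc\<close>).

  Upper bound. In all three cases there are maps \<open>\<phi>\<close> and \<open>\<theta>\<close> of \<open>G\<close> such that a factor \<open>y\<close> put
  in front of the first argument of \<open>\<omega>\<close> comes out in front of the value as \<open>\<phi> y\<close>, and a factor put
  behind the last argument comes out behind the value as \<open>\<theta> y\<close>. For \<open>a x\<^sub>1 \<dots> x\<^sub>r\<close> they are conjugation
  by \<open>a\<close> and the identity, for \<open>x\<^sub>1 \<dots> x\<^sub>r b\<close> the identity and conjugation by the inverse of \<open>b\<close>, and
  in the twisted case both are \<open>\<psi>\<close>. Along the leftmost branch of a tree \<open>\<phi>\<close> is
  applied once per level, so two trees with the same operation have leftmost depths \<open>m\<close> and
  \<open>n\<close> with \<open>\<phi>\<^sup>m = \<phi>\<^sup>n\<close>, which forces \<open>m - n\<close> to be a multiple of the order of \<open>\<phi>\<close>; likewise on the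
  right (\<open>ldepth_iterates_eq\<close>, \<open>rdepth_iterates_eq\<close>).

  Lower bound. In each case some tree \<open>B\<close> with at least three leaves evaluates to a central element
  times the plain product of its variables: the left comb with \<open>k\<close> carets, the right comb with
  \<open>k\<close> carets, and the complete tree of height \<open>h\<close>. Central elements can be moved out of the way,
  so two trees glued from equally many copies of \<open>B\<close> induce the same operation whatever
  their shapes. Since \<open>B\<close> has a first, a last and a further leaf, the outer depths of such trees can be
  prescribed independently while the further leaf balances the number of copies, and
  every integer multiple of the leftmost and rightmost depths of \<open>B\<close> is realised (\<open>depth_differences\<close>).
  These depths are \<open>(k, 1)\<close>, \<open>(1, k)\<close> and \<open>(h, h)\<close>, which agree with the upper bound.

  Finally, \<open>k\<close> and \<open>h\<close> are at least 2 because \<open>a\<close> and \<open>b\<close> are not central and \<open>\<psi>\<close> is not the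
  identity. So the image contains \<open>(1, 0)\<close> only in the second case and \<open>(0, 1)\<close> only in the first,
  and its diagonal elements \<open>(m, m)\<close> are given by the multiples \<open>m\<close> of the order.\<close>

section \<open>Outermost leaves of a tree\<close>

fun ldepth :: "tree \<Rightarrow> nat" where
  "ldepth Leaf = 0"
| "ldepth (Node []) = 0"
| "ldepth (Node (t # ts)) = Suc (ldepth t)"

text \<open>The recursion runs through the list of subtrees in order to be structural; \<open>rdepth_snoc\<close>
  is the equation that proofs use.\<close>
fun rdepth :: "tree \<Rightarrow> nat" where
  "rdepth Leaf = 0"
| "rdepth (Node []) = 0"
| "rdepth (Node [t]) = Suc (rdepth t)"
| "rdepth (Node (t # u # ts)) = rdepth (Node (u # ts))"

lemma rdepth_snoc [simp]: "rdepth (Node (ts @ [t])) = Suc (rdepth t)"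
proof (induction ts)
  case (Cons u us)
  then show ?case by (cases us) auto
qed simp

lemma leaves_pos: "full r T \<Longrightarrow> r \<ge> 1 \<Longrightarrow> leaves T \<ge> 1"
proof (induction T)
  case (Node ts)
  then obtain t ts' where "ts = t # ts'" by (cases ts) auto
  with Node show ?case by (auto intro: trans_le_add1)
qed simp

section \<open>Slopes at the end points\<close>

lemma intervals_list_append:
  "intervals_list r a l (ts @ us)
   = intervals_list r a l ts @ intervals_list r (a + real (length ts) * l) l us"
  by (induction ts arbitrary: a) (simp_all add: algebra_simps)

lemma length_intervals: "length (intervals r a l T) = leaves T"
  and length_intervals_list: "length (intervals_list r a l ts) = sum_list (map leaves ts)"
  by (induction r a l T and r a l ts rule: intervals_intervals_list.induct) auto

lemma interval_ends:
  shows "r \<ge> 1 \<Longrightarrow> full r T \<Longrightarrow> l > 0 \<Longrightarrow> (b, m) \<in> set (intervals r a l T)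
      \<Longrightarrow> m > 0 \<and> b + m \<le> a + l"
    and "r \<ge> 1 \<Longrightarrow> \<forall>t\<in>set ts. full r t \<Longrightarrow> l > 0 \<Longrightarrow> (b, m) \<in> set (intervals_list r a l ts)
      \<Longrightarrow> m > 0 \<and> b + m \<le> a + real (length ts) * l"
proof (induction r a l T and r a l ts rule: intervals_intervals_list.induct)
  case (2 r a l ts)
  then have "real (length ts) * (l / real r) = l" by auto
  with 2 show ?case by auto
next
  case (4 r a l t ts)
  from 4(6) consider "(b, m) \<in> set (intervals r a l t)"
    | "(b, m) \<in> set (intervals_list r (a + l) l ts)" by auto
  then show ?case
  proof cases
    case 1
    with 4 have "m > 0" "b + m \<le> a + l" by auto
    moreover have "0 \<le> real (length ts) * l" using 4(5) by simp
    ultimately show ?thesis by (simp add: algebra_simps)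
  next
    case 2
    with 4 show ?thesis by (auto simp: algebra_simps)
  qed
qed auto

text \<open>Every level on the way to the leftmost leaf divides the length by \<open>r\<close> and keeps the left
  end point.\<close>
lemma first_interval:
  assumes "r \<ge> 1"
  shows "full r T \<Longrightarrow> \<exists>I. intervals r a l T = (a, l / real r ^ ldepth T) # I"
proof (induction T arbitrary: l)
  case (Node ts)
  then obtain t ts' where ts: "ts = t # ts'" using assms by (cases ts) auto
  from Node(1)[of t "l / real r"] Node(2) ts
  obtain I where "intervals r a (l / real r) t = (a, l / real r / real r ^ ldepth t) # I" by auto
  then show ?case by (simp add: ts)
qed simp

text \<open>The bound on the earlier intervals is what makes \<open>affine_pieces\<close> skip them just
  below the right end point.\<close>
lemma last_interval:
  assumes "r \<ge> 1"
  shows "full r T \<Longrightarrow> l > 0 \<Longrightarrow>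
    \<exists>I. intervals r a l T = I @ [(a + l - l / real r ^ rdepth T, l / real r ^ rdepth T)]
      \<and> (\<forall>(b, m)\<in>set I. b + m \<le> a + l - l / real r ^ rdepth T)"
proof (induction T arbitrary: a l)
  case (Node ts)
  then obtain t us where ts: "ts = us @ [t]" using assms by (cases ts rule: rev_cases) auto
  define l' where "l' = l / real r"
  define a' where "a' = a + real (length us) * l'"
  have l': "l' > 0" using Node(3) assms by (simp add: l'_def)
  have len: "real (length us) = real r - 1" using Node(2) ts by auto
  have end_eq: "a' + l' = a + l"
    using assms by (simp add: a'_def l'_def len field_simps)
  from Node(1)[of t l' a'] Node(2) ts l' obtain I where
    I: "intervals r a' l' t = I @ [(a' + l' - l' / real r ^ rdepth t, l' / real r ^ rdepth t)]"
       "\<forall>(b, m)\<in>set I. b + m \<le> a' + l' - l' / real r ^ rdepth t" by auto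
  have d: "l' / real r ^ rdepth t = l / real r ^ rdepth (Node ts)"
    by (simp add: ts l'_def)
  have le: "a' \<le> a' + l' - l' / real r ^ rdepth t"
    using l' assms by (simp add: divide_le_eq mult_le_cancel_left1)
  have "b + m \<le> a' + l' - l' / real r ^ rdepth t"
    if "(b, m) \<in> set (intervals_list r a l' us)" for b m
    using interval_ends(2)[OF assms _ l' that] Node(2) ts le by (auto simp: a'_def)
  then show ?case
    using I le unfolding d end_eq
    by (intro exI[of _ "intervals_list r a l' us @ I"])
       (auto simp: ts intervals_list_append l'_def[symmetric] a'_def[symmetric] d end_eq)
qed simp

text \<open>The length of the prefix is recorded because \<open>T\<close> and \<open>U\<close> are expanded at the same position: their
  lists of intervals then change at the same place and stay aligned.\<close>
lemma intervals_expand: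
  shows "r \<ge> 1 \<Longrightarrow> i < leaves T \<Longrightarrow> l > 0 \<Longrightarrow>
    \<exists>I c m I'. intervals r a l T = I @ (c, m) # I' \<and> length I = i \<and> m > 0 \<and>
      intervals r a l (expand r i T) = I @ intervals_list r c (m / real r) (replicate r Leaf) @ I'"
    and "r \<ge> 1 \<Longrightarrow> i < sum_list (map leaves ts) \<Longrightarrow> l > 0 \<Longrightarrow>
    \<exists>I c m I'. intervals_list r a l ts = I @ (c, m) # I' \<and> length I = i \<and> m > 0 \<and>
      intervals_list r a l (expand_list r i ts)
        = I @ intervals_list r c (m / real r) (replicate r Leaf) @ I'"
proof (induction r i T and r i ts arbitrary: a l and a l rule: expand_expand_list.induct)
  case (2 r i ts)
  then show ?case by simp
next
  case (4 r i t ts)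
  show ?case
  proof (cases "i < leaves t")
    case True
    from 4(1)[OF True 4(3) True 4(5), of a] obtain I c m I' where
      "intervals r a l t = I @ (c, m) # I'" "length I = i" "m > 0"
      "intervals r a l (expand r i t)
        = I @ intervals_list r c (m / real r) (replicate r Leaf) @ I'" by auto
    then show ?thesis using True
      by (intro exI[of _ I] exI[of _ c] exI[of _ m]
          exI[of _ "I' @ intervals_list r (a + l) l ts"]) auto
  next
    case False
    then have "i - leaves t < sum_list (map leaves ts)" using 4(4) by auto
    from 4(2)[OF False 4(3) this 4(5), of "a + l"] obtain I c m I' where
      "intervals_list r (a + l) l ts = I @ (c, m) # I'" "length I = i - leaves t" "m > 0"
      "intervals_list r (a + l) l (expand_list r (i - leaves t) ts)
        = I @ intervals_list r c (m / real r) (replicate r Leaf) @ I'" by auto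
    then show ?thesis using False
      by (intro exI[of _ "intervals r a l t @ I"] exI[of _ c] exI[of _ m] exI[of _ I'])
         (auto simp: length_intervals)
  qed
qed auto

lemma affine_pieces_append_cong:
  assumes "length I = length J" "affine_pieces I1 J1 x = affine_pieces I2 J2 x"
  shows "affine_pieces (I @ I1) (J @ J1) x = affine_pieces (I @ I2) (J @ J2) x"
  using assms by (induction I J rule: list_induct2) auto

text \<open>Subdividing a domain interval and its image interval into equally many equal parts changes
  neither the slope nor the map.\<close>
lemma affine_pieces_subdivided:
  assumes "l > 0"
  shows "affine_pieces (intervals_list r a l (replicate n Leaf) @ I)
           (intervals_list r b m (replicate n Leaf) @ J) x =
    (if n > 0 \<and> x \<le> a + real n * l then b + (x - a) * (m / l) else affine_pieces I J x)"
proof (induction n arbitrary: a b)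
  case (Suc n)
  show ?case
  proof (cases "x \<le> a + l")
    case True
    moreover have "a + l \<le> a + real (Suc n) * l" using assms by (simp add: algebra_simps)
    ultimately have "x \<le> a + real (Suc n) * l" by linarith
    with True show ?thesis by simp
  next
    case False
    have "b + m + (x - (a + l)) * (m / l) = b + (x - a) * (m / l)"
      using assms by (simp add: field_simps)
    with False show ?thesis by (simp add: Suc.IH) (auto simp: algebra_simps)
  qed
qed simp

lemma pl_map_expand:
  assumes "r \<ge> 1" "leaves T = leaves U" "i < leaves T"
  shows "pl_map r (expand r i T, expand r i U) = pl_map r (T, U)"
proof -
  obtain I c m I' where T: "intervals r 0 1 T = I @ (c, m) # I'" "length I = i" "m > 0"
    "intervals r 0 1 (expand r i T) = I @ intervals_list r c (m / real r) (replicate r Leaf) @ I'"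
    using intervals_expand(1)[OF assms(1,3), of 1 0] by auto
  obtain J d n J' where U: "intervals r 0 1 U = J @ (d, n) # J'" "length J = i" "n > 0"
    "intervals r 0 1 (expand r i U) = J @ intervals_list r d (n / real r) (replicate r Leaf) @ J'"
    using intervals_expand(1)[OF assms(1), of i U 1 0] assms by auto
  have "affine_pieces (intervals r 0 1 (expand r i T)) (intervals r 0 1 (expand r i U))
      = affine_pieces (intervals r 0 1 T) (intervals r 0 1 U)"
    unfolding T U using assms(1) \<open>m > 0\<close> T(2) U(2)
    by (intro ext affine_pieces_append_cong) (auto simp: affine_pieces_subdivided)
  then show ?thesis by (simp add: pl_map_def)
qed

lemma pl_map_expansion_equiv:
  assumes "r \<ge> 1" "(p, p') \<in> expansion_equiv r"
  shows "pl_map r p' = pl_map r p"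
proof -
  have "(p, p') \<in> (expansion_step r \<union> (expansion_step r)\<inverse>)\<^sup>*"
    using assms(2) by (simp add: expansion_equiv_def)
  then show ?thesis
  proof (induction rule: rtrancl_induct)
    case (step y z)
    then have "pl_map r y = pl_map r z"
      using pl_map_expand[OF assms(1)] by (auto simp: expansion_step_def tree_pairs_def)
    with step.IH show ?case by simp
  qed simp
qed

text \<open>Expansion does not change the map, so the image under \<open>pl_map\<close> of an equivalence class is a
  singleton and any representative computes \<open>homeo\<close>.\<close>
lemma homeo_eq_pl_map:
  assumes "r \<ge> 1" "g \<in> carrier (HT r)" "p \<in> g"
  shows "homeo r g = pl_map r p"
proof -
  from assms(2) obtain p0 where "g = expansion_equiv r `` {p0}"
    by (auto simp: HT_def elim: quotientE)
  then have "pl_map r ` g = {pl_map r p}"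
    using pl_map_expansion_equiv[OF assms(1)] assms(3) by (auto simp: image_iff)
  then show ?thesis by (simp add: homeo_def)
qed

lemma affine_pieces_last:
  assumes "length I = length J" "\<forall>(b, m)\<in>set I. b + m < x" "x \<le> a + l"
  shows "affine_pieces (I @ [(a, l)]) (J @ [(b, m)]) x = b + (x - a) * (m / l)"
  using assms by (induction I J rule: list_induct2) auto

lemma vector_derivative_affine:
  fixes f :: "real \<Rightarrow> real"
  assumes "e > 0"
  shows vector_derivative_affine_at_right:
      "(\<And>x. c \<le> x \<Longrightarrow> x \<le> c + e \<Longrightarrow> f x = b + (x - a) * s) \<Longrightarrow> vector_derivative f (at_right c) = s"
    and vector_derivative_affine_at_left:
      "(\<And>x. c - e \<le> x \<Longrightarrow> x \<le> c \<Longrightarrow> f x = b + (x - a) * s) \<Longrightarrow> vector_derivative f (at_left c) = s"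
proof -
  have affine: "((\<lambda>x. b + (x - a) * s) has_vector_derivative s) (at c within S)" for S
    by (auto intro!: derivative_eq_intros simp flip: has_real_derivative_iff_has_vector_derivative)
  {
    assume "\<And>x. c \<le> x \<Longrightarrow> x \<le> c + e \<Longrightarrow> f x = b + (x - a) * s"
    then have "(f has_vector_derivative s) (at c within {c..c + e})"
      using assms by (intro has_vector_derivative_transform[OF _ _ affine]) auto
    then show "vector_derivative f (at_right c) = s"
      using assms by (intro vector_derivative_within) (auto simp: at_within_Icc_at_right)
  }
  {
    assume "\<And>x. c - e \<le> x \<Longrightarrow> x \<le> c \<Longrightarrow> f x = b + (x - a) * s"
    then have "(f has_vector_derivative s) (at c within {c - e..c})"
      using assms by (intro has_vector_derivative_transform[OF _ _ affine]) auto
    then show "vector_derivative f (at_left c) = s"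
      using assms by (intro vector_derivative_within) (auto simp: at_within_Icc_at_left)
  }
qed

lemma bdry_eq_depth_differences:
  assumes "r \<ge> 2" "g \<in> carrier (HT r)" "(T, U) \<in> g" "(T, U) \<in> tree_pairs r"
  shows "bdry r g = (real (ldepth T) - real (ldepth U), real (rdepth T) - real (rdepth U))"
proof -
  have r: "r \<ge> 1" "real r > 1" using assms(1) by auto
  have T: "full r T" and U: "full r U" and eq: "leaves T = leaves U"
    using assms(4) by (auto simp: tree_pairs_def)
  have homeo: "homeo r g x = affine_pieces (intervals r 0 1 T) (intervals r 0 1 U) x"
    if "0 \<le> x" "x \<le> 1" for x
    using homeo_eq_pl_map[OF r(1) assms(2,3)] that by (simp add: pl_map_def)
  have slope: "log (real r) ((1 / real r ^ n) / (1 / real r ^ m)) = real m - real n" for m n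
    using r by (simp add: log_divide log_nat_power)
  have pos: "1 / real r ^ n > 0" "1 / real r ^ n \<le> 1" for n
    using r by (auto simp: divide_le_eq)

  define lT lU where "lT = 1 / real r ^ ldepth T" and "lU = 1 / real r ^ ldepth U"
  obtain I J where "intervals r 0 1 T = (0, lT) # I" "intervals r 0 1 U = (0, lU) # J"
    using first_interval[OF r(1) T, of 0 1] first_interval[OF r(1) U, of 0 1]
    by (auto simp: lT_def lU_def)
  then have slope0: "vector_derivative (homeo r g) (at_right 0) = lU / lT"
    using pos[of "ldepth T", folded lT_def]
    by (intro vector_derivative_affine_at_right[where e = lT and b = 0 and a = 0])
       (auto simp: homeo)

  define mT mU where "mT = 1 / real r ^ rdepth T" and "mU = 1 / real r ^ rdepth U"
  obtain I J where IJ: "intervals r 0 1 T = I @ [(1 - mT, mT)]"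
      "\<forall>(b, m)\<in>set I. b + m \<le> 1 - mT" "intervals r 0 1 U = J @ [(1 - mU, mU)]"
    using last_interval[OF r(1) T, of 1 0] last_interval[OF r(1) U, of 1 0]
    by (auto simp: mT_def mU_def)
  have len: "length I = length J"
    using length_intervals[of r 0 1 T] length_intervals[of r 0 1 U] eq IJ by auto
  have "mT > 0" "mT \<le> 1" using pos[of "rdepth T"] by (auto simp: mT_def)
  \<comment> \<open>The first half of the last interval is left out: its left end point belongs to the previous piece.\<close>
  have "homeo r g x = (1 - mU) + (x - (1 - mT)) * (mU / mT)"
    if "1 - mT / 2 \<le> x" "x \<le> 1" for x
  proof -
    have "\<forall>(b, m)\<in>set I. b + m < x" using IJ(2) that \<open>mT > 0\<close> by fastforce
    with len \<open>mT \<le> 1\<close> that show ?thesis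
      by (simp add: homeo IJ(1,3) affine_pieces_last)
  qed
  then have slope1: "vector_derivative (homeo r g) (at_left 1) = mU / mT"
    using \<open>mT > 0\<close> by (intro vector_derivative_affine_at_left[where e = "mT / 2"]) auto
  show ?thesis
    unfolding bdry_def slope0 slope1 unfolding lT_def lU_def mT_def mU_def by (simp only: slope)
qed

text \<open>Membership in \<open>Assoc\<close> asks for one suitable representative, and the boundary value may be read off
  from that same representative.\<close>
lemma bdry_Assoc:
  assumes "r \<ge> 2"
  shows "bdry r ` Assoc r Q q =
    {(real (ldepth T) - real (ldepth U), real (rdepth T) - real (rdepth U)) | T U.
      (T, U) \<in> tree_pairs r \<and> (\<forall>xs\<in>tuples (leaves T) Q. eval q T xs = eval q U xs)}"
    (is "_ = ?D")
proof (intro equalityI subsetI)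
  fix y assume "y \<in> bdry r ` Assoc r Q q"
  then obtain g T U where g: "g \<in> carrier (HT r)" "(T, U) \<in> g" "y = bdry r g"
    "\<forall>xs\<in>tuples (leaves T) Q. eval q T xs = eval q U xs" by (auto simp: Assoc_def)
  then have TU: "(T, U) \<in> tree_pairs r"
    by (auto simp: HT_def expansion_equiv_def elim: quotientE)
  show "y \<in> ?D"
    using bdry_eq_depth_differences[OF assms g(1,2) TU] g TU by blast
next
  fix y assume "y \<in> ?D"
  then obtain T U where TU: "(T, U) \<in> tree_pairs r"
    "\<forall>xs\<in>tuples (leaves T) Q. eval q T xs = eval q U xs"
    and y: "y = (real (ldepth T) - real (ldepth U), real (rdepth T) - real (rdepth U))" by blast
  define g where "g = expansion_equiv r `` {(T, U)}"
  have g: "g \<in> carrier (HT r)" "(T, U) \<in> g"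
    using TU(1) equiv_class_self[OF equiv_expansion_equiv TU(1)]
    by (auto simp: g_def HT_def quotientI)
  then have "g \<in> Assoc r Q q" using TU(2) by (auto simp: Assoc_def)
  then show "y \<in> bdry r ` Assoc r Q q"
    using bdry_eq_depth_differences[OF assms g TU(1)] y by (metis image_eqI)
qed

section \<open>Operations of trees and grafting\<close>

lemma eval_list_append:
  "eval_list q (ts @ us) xs
   = eval_list q ts (take (sum_list (map leaves ts)) xs)
     @ eval_list q us (drop (sum_list (map leaves ts)) xs)"
  by (induction ts arbitrary: xs) (auto simp: drop_take min_def add.commute)

lemma length_eval_list [simp]: "length (eval_list q ts xs) = length ts"
  by (induction ts arbitrary: xs) auto

lemma eval_list_Leaves: "length xs = n \<Longrightarrow> eval_list q (replicate n Leaf) xs = xs"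
proof (induction n arbitrary: xs)
  case (Suc n)
  then show ?case by (cases xs) auto
qed simp

lemma tuples_take: "xs \<in> tuples (m + n) Q \<Longrightarrow> take m xs \<in> tuples m Q"
  and tuples_drop: "xs \<in> tuples (m + n) Q \<Longrightarrow> drop m xs \<in> tuples n Q"
  by (auto simp: tuples_def dest: in_set_takeD in_set_dropD)

lemma tuples_Cons: "x \<in> Q \<Longrightarrow> xs \<in> tuples n Q \<Longrightarrow> x # xs \<in> tuples (Suc n) Q"
  by (auto simp: tuples_def)

lemma eval_closed:
  shows "\<forall>xs\<in>tuples r Q. q xs \<in> Q \<Longrightarrow> full r T \<Longrightarrow> xs \<in> tuples (leaves T) Q \<Longrightarrow> eval q T xs \<in> Q"
    and "\<forall>xs\<in>tuples r Q. q xs \<in> Q \<Longrightarrow> \<forall>t\<in>set ts. full r t \<Longrightarrow>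
      xs \<in> tuples (sum_list (map leaves ts)) Q \<Longrightarrow> eval_list q ts xs \<in> tuples (length ts) Q"
proof (induction q T xs and q ts xs rule: eval_eval_list.induct)
  case (1 q xs)
  then show ?case by (cases xs) (auto simp: tuples_def)
next
  case (2 q ts xs)
  then have "eval_list q ts xs \<in> tuples r Q" by fastforce
  with 2(2) show ?case by simp
next
  case (3 q xs)
  then show ?case by (simp add: tuples_def)
next
  case (4 q t ts xs)
  then have "take (leaves t) xs \<in> tuples (leaves t) Q"
    "drop (leaves t) xs \<in> tuples (sum_list (map leaves ts)) Q"
    by (auto intro: tuples_take tuples_drop)
  with 4(1,2) 4(3,4) show ?case by (simp add: tuples_Cons)
qed

text \<open>Evaluating a tree in the algebra of trees, with \<open>Node\<close> as the operation, substitutes trees for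
  its leaves.\<close>
abbreviation graft :: "tree \<Rightarrow> tree list \<Rightarrow> tree" where
  "graft \<equiv> eval Node"

lemma leaves_graft:
  shows "length ts = leaves B \<Longrightarrow> leaves (graft B ts) = sum_list (map leaves ts)"
    and "length ts = sum_list (map leaves bs) \<Longrightarrow>
      sum_list (map leaves (eval_list Node bs ts)) = sum_list (map leaves ts)"
proof (induction "Node" B ts and "Node" bs ts rule: eval_eval_list.induct)
  case (1 ts)
  then show ?case by (cases ts) auto
next
  case (4 b bs ts)
  have "sum_list (map leaves (take (leaves b) ts)) + sum_list (map leaves (drop (leaves b) ts))
      = sum_list (map leaves ts)"
    by (metis append_take_drop_id map_append sum_list_append)
  with 4 show ?case by simp
qed auto

lemma full_graft:
  shows "full r B \<Longrightarrow> length ts = leaves B \<Longrightarrow> \<forall>t\<in>set ts. full r t \<Longrightarrow> full r (graft B ts)"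
    and "\<forall>b\<in>set bs. full r b \<Longrightarrow> length ts = sum_list (map leaves bs) \<Longrightarrow> \<forall>t\<in>set ts. full r t
      \<Longrightarrow> \<forall>t\<in>set (eval_list Node bs ts). full r t"
proof (induction "Node" B ts and "Node" bs ts rule: eval_eval_list.induct)
  case (1 ts)
  then show ?case by (cases ts) auto
next
  case (4 b bs ts)
  have "full r (graft b (take (leaves b) ts))"
    by (rule 4(1)) (use 4(3-5) in \<open>auto dest: in_set_takeD\<close>)
  moreover have "\<forall>t\<in>set (eval_list Node bs (drop (leaves b) ts)). full r t"
    by (rule 4(2)) (use 4(3-5) in \<open>auto dest: in_set_dropD\<close>)
  ultimately show ?case by simp
next
  case (2 bs ts)
  then have "\<forall>t\<in>set (eval_list Node bs ts). full r t" by simp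
  with 2(2) show ?case by simp
qed simp

text \<open>Substitution of trees is composition of operations. This is associativity of
  evaluation: the inner trees consume the variables, and the outer tree consumes their values.\<close>
lemma eval_graft:
  shows "length ts = leaves B \<Longrightarrow> length xs = sum_list (map leaves ts) \<Longrightarrow>
      eval q (graft B ts) xs = eval q B (eval_list q ts xs)"
    and "length ts = sum_list (map leaves bs) \<Longrightarrow> length xs = sum_list (map leaves ts) \<Longrightarrow>
      eval_list q (eval_list Node bs ts) xs = eval_list q bs (eval_list q ts xs)"
proof (induction "Node" B ts and "Node" bs ts arbitrary: xs and xs rule: eval_eval_list.induct)
  case (1 ts)
  then obtain t where "ts = [t]" by (cases ts) auto
  with 1 show ?case by simp
next
  case (4 b bs ts)
  define us vs where "us = take (leaves b) ts" and "vs = drop (leaves b) ts"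
  have ts: "ts = us @ vs" and len: "length us = leaves b" "length vs = sum_list (map leaves bs)"
    using 4(3) by (auto simp: us_def vs_def)
  define n where "n = sum_list (map leaves us)"
  have xs: "length (take n xs) = n" "length (drop n xs) = sum_list (map leaves vs)"
    using 4(4) by (auto simp: ts n_def)
  have "eval_list q (eval_list Node (b # bs) ts) xs
      = eval q (graft b us) (take n xs) # eval_list q (eval_list Node bs vs) (drop n xs)"
    using leaves_graft(1)[OF len(1)] by (simp add: us_def vs_def n_def)
  also have "\<dots> = eval q b (eval_list q us (take n xs)) # eval_list q bs (eval_list q vs (drop n xs))"
    using 4(1)[folded us_def, OF len(1), of "take n xs"]
      4(2)[folded vs_def, OF len(2), of "drop n xs"] xs by (simp add: n_def)
  also have "\<dots> = eval_list q (b # bs) (eval_list q ts xs)"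
    by (simp add: ts eval_list_append n_def len)
  finally show ?case .
next
  case (2 bs ts)
  have "eval_list q (eval_list Node bs ts) xs = eval_list q bs (eval_list q ts xs)"
    by (rule 2(1)) (use 2(2,3) in simp_all)
  then show ?case by simp
qed simp

lemma ldepth_graft:
  assumes "r \<ge> 1"
  shows "full r B \<Longrightarrow> length ts = leaves B \<Longrightarrow> ldepth (graft B ts) = ldepth B + ldepth (hd ts)"
proof (induction B arbitrary: ts)
  case (Node bs)
  from Node(2) obtain b bs' where bs: "bs = b # bs'" using assms by (cases bs) auto
  have "full r b" using Node(2) by (simp add: bs)
  then have "leaves b \<ge> 1" using assms by (rule leaves_pos)
  then have "hd (take (leaves b) ts) = hd ts" by simp
  then show ?case using Node(1)[of b "take (leaves b) ts"] Node(2,3) bs by simp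
qed simp

lemma rdepth_graft:
  assumes "r \<ge> 1"
  shows "full r B \<Longrightarrow> length ts = leaves B \<Longrightarrow> rdepth (graft B ts) = rdepth B + rdepth (last ts)"
proof (induction B arbitrary: ts)
  case Leaf
  then show ?case by (cases ts) auto
next
  case (Node bs)
  from Node(2) obtain b bs' where bs: "bs = bs' @ [b]" using assms by (cases bs rule: rev_cases) auto
  have "full r b" using Node(2) by (simp add: bs)
  then have "leaves b \<ge> 1" using assms by (rule leaves_pos)
  then have "last (drop (sum_list (map leaves bs')) ts) = last ts"
    using Node(3) bs by (intro last_drop) auto
  then show ?case
    using Node(1)[of b "drop (sum_list (map leaves bs')) ts"] Node(2,3) bs
    by (simp add: eval_list_append)
qed

fun left_comb :: "tree \<Rightarrow> nat \<Rightarrow> tree" where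
  "left_comb B 0 = Leaf"
| "left_comb B (Suc n) = graft B (left_comb B n # replicate (leaves B - 1) Leaf)"

fun right_comb :: "tree \<Rightarrow> nat \<Rightarrow> tree" where
  "right_comb B 0 = Leaf"
| "right_comb B (Suc n) = graft B (replicate (leaves B - 1) Leaf @ [right_comb B n])"

fun complete_tree :: "nat \<Rightarrow> nat \<Rightarrow> tree" where
  "complete_tree r 0 = Leaf"
| "complete_tree r (Suc n) = Node (replicate r (complete_tree r n))"

lemma full_leaves_depth_left_comb:
  assumes "r \<ge> 1" "full r B"
  shows "full r (left_comb B n) \<and> leaves (left_comb B n) = n * (leaves B - 1) + 1
    \<and> ldepth (left_comb B n) = n * ldepth B"
proof (induction n)
  case (Suc n)
  define ts where "ts = left_comb B n # replicate (leaves B - 1) Leaf"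
  have ts: "length ts = leaves B" "\<forall>t\<in>set ts. full r t" "hd ts = left_comb B n"
      "sum_list (map leaves ts) = leaves (left_comb B n) + (leaves B - 1)"
    using Suc leaves_pos[OF assms(2,1)] by (auto simp: ts_def sum_list_replicate)
  have "left_comb B (Suc n) = graft B ts" by (simp add: ts_def)
  then show ?case
    using full_graft(1)[OF assms(2) ts(1,2)] leaves_graft(1)[OF ts(1)]
      ldepth_graft[OF assms ts(1)] Suc ts(3,4) by simp
qed auto

lemma full_leaves_depth_right_comb:
  assumes "r \<ge> 1" "full r B"
  shows "full r (right_comb B n) \<and> leaves (right_comb B n) = n * (leaves B - 1) + 1
    \<and> rdepth (right_comb B n) = n * rdepth B"
proof (induction n)
  case (Suc n)
  define ts where "ts = replicate (leaves B - 1) Leaf @ [right_comb B n]"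
  have ts: "length ts = leaves B" "\<forall>t\<in>set ts. full r t" "last ts = right_comb B n"
      "sum_list (map leaves ts) = leaves (right_comb B n) + (leaves B - 1)"
    using Suc leaves_pos[OF assms(2,1)] by (auto simp: ts_def sum_list_replicate)
  have "right_comb B (Suc n) = graft B ts" by (simp add: ts_def)
  then show ?case
    using full_graft(1)[OF assms(2) ts(1,2)] leaves_graft(1)[OF ts(1)]
      rdepth_graft[OF assms ts(1)] Suc ts(3,4) by simp
qed auto

lemma full_leaves_depth_complete_tree:
  assumes "r \<ge> 1"
  shows "full r (complete_tree r n) \<and> leaves (complete_tree r n) = r ^ n
    \<and> ldepth (complete_tree r n) = n \<and> rdepth (complete_tree r n) = n"
proof (induction n)
  case (Suc n)
  obtain m where m: "r = Suc m" using assms by (cases r) auto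
  have "rdepth (complete_tree r (Suc n)) = Suc (rdepth (complete_tree r n))"
    using rdepth_snoc[of "replicate m (complete_tree r n)" "complete_tree r n"]
    by (simp add: m replicate_append_same)
  moreover have "ldepth (complete_tree r (Suc n)) = Suc (ldepth (complete_tree r n))"
    by (simp add: m)
  ultimately show ?case using Suc by (auto simp: sum_list_replicate simp del: rdepth.simps ldepth.simps)
qed auto

section \<open>Factors at the outermost variables\<close>

context group
begin

text \<open>The twist records what happens to an outer factor on its way through one application of the
  operation. Conjugation, the identity and \<open>\<psi>\<close> occur as twists below.\<close>
definition left_twist :: "nat \<Rightarrow> ('a list \<Rightarrow> 'a) \<Rightarrow> ('a \<Rightarrow> 'a) \<Rightarrow> bool" where
  "left_twist r q \<phi> \<longleftrightarrow> \<phi> \<in> carrier G \<rightarrow> carrier G \<and>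
    (\<forall>y\<in>carrier G. \<forall>c cs. c # cs \<in> tuples r (carrier G)
      \<longrightarrow> q ((y \<otimes> c) # cs) = \<phi> y \<otimes> q (c # cs))"

definition right_twist :: "nat \<Rightarrow> ('a list \<Rightarrow> 'a) \<Rightarrow> ('a \<Rightarrow> 'a) \<Rightarrow> bool" where
  "right_twist r q \<phi> \<longleftrightarrow> \<phi> \<in> carrier G \<rightarrow> carrier G \<and>
    (\<forall>y\<in>carrier G. \<forall>c cs. cs @ [c] \<in> tuples r (carrier G)
      \<longrightarrow> q (cs @ [c \<otimes> y]) = q (cs @ [c]) \<otimes> \<phi> y)"

text \<open>The first variable passes through one application of \<open>q\<close> for each level of the leftmost branch,
  and each of them contributes one application of \<open>\<phi>\<close>.\<close>
lemma eval_left_mult: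
  assumes "r \<ge> 1" and closed: "\<forall>xs\<in>tuples r (carrier G). q xs \<in> carrier G"
    and twist: "left_twist r q \<phi>"
    and y: "y \<in> carrier G"
  shows "full r T \<Longrightarrow> x # xs \<in> tuples (leaves T) (carrier G) \<Longrightarrow>
    eval q T ((y \<otimes> x) # xs) = (\<phi> ^^ ldepth T) y \<otimes> eval q T (x # xs)"
proof (induction T arbitrary: xs)
  case (Node ts)
  from twist have \<phi>: "\<phi> \<in> carrier G \<rightarrow> carrier G" by (simp add: left_twist_def)
  have pow: "(\<phi> ^^ n) y \<in> carrier G" for n using \<phi> y by (induction n) auto
  obtain t ts' where ts: "ts = t # ts'" using Node(2) assms(1) by (cases ts) auto
  have full: "full r t" "\<forall>t\<in>set ts'. full r t" using Node(2) ts by auto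
  obtain n where n: "leaves t = Suc n"
    using leaves_pos[OF full(1) assms(1)] by (cases "leaves t") auto
  have t: "x # take n xs \<in> tuples (leaves t) (carrier G)"
    and ts': "drop n xs \<in> tuples (sum_list (map leaves ts')) (carrier G)"
    using Node(3) ts n tuples_take[of "x # xs" "leaves t" _ "carrier G"]
      tuples_drop[of "x # xs" "leaves t" _ "carrier G"] by auto
  have "eval q t (x # take n xs) # eval_list q ts' (drop n xs) \<in> tuples r (carrier G)"
    using eval_closed(1)[OF closed full(1) t] eval_closed(2)[OF closed full(2) ts'] Node(2) ts
    by (auto simp: tuples_def)
  with twist pow[of "ldepth t"] Node(1)[of t "take n xs"] full t show ?case
    by (simp add: ts n left_twist_def)
qed simp

lemma eval_right_mult:
  assumes "r \<ge> 1" and closed: "\<forall>xs\<in>tuples r (carrier G). q xs \<in> carrier G"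
    and twist: "right_twist r q \<phi>"
    and y: "y \<in> carrier G"
  shows "full r T \<Longrightarrow> xs @ [x] \<in> tuples (leaves T) (carrier G) \<Longrightarrow>
    eval q T (xs @ [x \<otimes> y]) = eval q T (xs @ [x]) \<otimes> (\<phi> ^^ rdepth T) y"
proof (induction T arbitrary: xs)
  case Leaf
  then show ?case by (simp add: tuples_def)
next
  case (Node ts)
  from twist have \<phi>: "\<phi> \<in> carrier G \<rightarrow> carrier G" by (simp add: right_twist_def)
  have pow: "(\<phi> ^^ n) y \<in> carrier G" for n using \<phi> y by (induction n) auto
  obtain t ts' where ts: "ts = ts' @ [t]" using Node(2) assms(1) by (cases ts rule: rev_cases) auto
  have full: "full r t" "\<forall>t\<in>set ts'. full r t" using Node(2) ts by auto
  define n where "n = sum_list (map leaves ts')"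
  have n: "n \<le> length xs"
    using leaves_pos[OF full(1) assms(1)] Node(3) ts by (auto simp: tuples_def n_def)
  have t: "drop n xs @ [x] \<in> tuples (leaves t) (carrier G)"
    and ts': "take n xs \<in> tuples n (carrier G)"
    using Node(3) ts n tuples_take[of "xs @ [x]" n _ "carrier G"]
      tuples_drop[of "xs @ [x]" n _ "carrier G"] by (auto simp: n_def)
  have "eval_list q ts' (take n xs) @ [eval q t (drop n xs @ [x])] \<in> tuples r (carrier G)"
    using eval_closed(1)[OF closed full(1) t] eval_closed(2)[OF closed full(2) ts'[unfolded n_def]]
      Node(2) ts by (auto simp: tuples_def n_def)
  moreover have "leaves t + n - length xs = Suc 0" using t n by (auto simp: tuples_def)
  ultimately show ?case
    using twist pow[of "rdepth t"] Node(1)[of t "drop n xs"] full t n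
    by (simp add: ts right_twist_def eval_list_append n_def[symmetric])
qed

text \<open>Comparing the values of \<open>T\<close> and \<open>U\<close> with and without the factor \<open>y\<close>, all other arguments being 1,
  isolates the action of the leftmost branch.\<close>
lemma ldepth_iterates_eq:
  assumes "r \<ge> 1" and closed: "\<forall>xs\<in>tuples r (carrier G). q xs \<in> carrier G"
    and twist: "left_twist r q \<phi>"
    and TU: "(T, U) \<in> tree_pairs r"
      "\<forall>xs\<in>tuples (leaves T) (carrier G). eval q T xs = eval q U xs"
    and y: "y \<in> carrier G"
  shows "(\<phi> ^^ ldepth T) y = (\<phi> ^^ ldepth U) y"
proof -
  have full: "full r T" "full r U" "leaves T = leaves U" using TU(1) by (auto simp: tree_pairs_def)
  from twist have \<phi>: "\<phi> \<in> carrier G \<rightarrow> carrier G" by (simp add: left_twist_def)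
  have pow: "(\<phi> ^^ n) y \<in> carrier G" for n using \<phi> y by (induction n) auto
  define es where "es = replicate (leaves T - 1) \<one>"
  have es: "x # es \<in> tuples (leaves T) (carrier G)" if "x \<in> carrier G" for x
    using leaves_pos[OF full(1) assms(1)] that by (auto simp: es_def tuples_def)
  note mult = eval_left_mult[OF assms(1) closed twist y]
  have "(\<phi> ^^ ldepth T) y \<otimes> eval q T (\<one> # es) = (\<phi> ^^ ldepth U) y \<otimes> eval q T (\<one> # es)"
    using mult[OF full(1), of \<one> es] mult[OF full(2), of \<one> es] full(3) es TU(2) y
    by (metis m_closed one_closed)
  then show ?thesis using pow eval_closed(1)[OF closed full(1) es] by simp
qed

lemma rdepth_iterates_eq:
  assumes "r \<ge> 1" and closed: "\<forall>xs\<in>tuples r (carrier G). q xs \<in> carrier G"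
    and twist: "right_twist r q \<phi>"
    and TU: "(T, U) \<in> tree_pairs r"
      "\<forall>xs\<in>tuples (leaves T) (carrier G). eval q T xs = eval q U xs"
    and y: "y \<in> carrier G"
  shows "(\<phi> ^^ rdepth T) y = (\<phi> ^^ rdepth U) y"
proof -
  have full: "full r T" "full r U" "leaves T = leaves U" using TU(1) by (auto simp: tree_pairs_def)
  from twist have \<phi>: "\<phi> \<in> carrier G \<rightarrow> carrier G" by (simp add: right_twist_def)
  have pow: "(\<phi> ^^ n) y \<in> carrier G" for n using \<phi> y by (induction n) auto
  define es where "es = replicate (leaves T - 1) \<one>"
  have es: "es @ [x] \<in> tuples (leaves T) (carrier G)" if "x \<in> carrier G" for x
    using leaves_pos[OF full(1) assms(1)] that by (auto simp: es_def tuples_def)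
  note mult = eval_right_mult[OF assms(1) closed twist y]
  have "eval q T (es @ [\<one>]) \<otimes> (\<phi> ^^ rdepth T) y = eval q T (es @ [\<one>]) \<otimes> (\<phi> ^^ rdepth U) y"
    using mult[OF full(1), of es \<one>] mult[OF full(2), of es \<one>] full(3) es TU(2) y
    by (metis m_closed one_closed)
  then show ?thesis using pow eval_closed(1)[OF closed full(1) es] by simp
qed

end

section \<open>Central elements and products\<close>

context group
begin

lemma list_prod_Nil [simp]: "list_prod G [] = \<one>"
  and list_prod_Cons [simp]: "list_prod G (x # xs) = x \<otimes> list_prod G xs"
  by (simp_all add: list_prod_def)

lemma list_prod_closed [simp]: "set xs \<subseteq> carrier G \<Longrightarrow> list_prod G xs \<in> carrier G"
  by (induction xs) auto

lemma list_prod_append: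
  "set xs \<subseteq> carrier G \<Longrightarrow> set ys \<subseteq> carrier G
    \<Longrightarrow> list_prod G (xs @ ys) = list_prod G xs \<otimes> list_prod G ys"
  by (induction xs) (auto simp: m_assoc)

lemma list_prod_powers:
  "z \<in> carrier G \<Longrightarrow> list_prod G (map (\<lambda>n. z [^] n) ns) = z [^] sum_list (ns :: nat list)"
  by (induction ns) (auto simp: nat_pow_mult)

lemma center_closed: "z \<in> center G \<Longrightarrow> z \<in> carrier G"
  and center_commute: "z \<in> center G \<Longrightarrow> g \<in> carrier G \<Longrightarrow> z \<otimes> g = g \<otimes> z"
  unfolding center_def by blast+

lemma centerI:
  "z \<in> carrier G \<Longrightarrow> (\<And>g. g \<in> carrier G \<Longrightarrow> z \<otimes> g = g \<otimes> z) \<Longrightarrow> z \<in> center G"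
  unfolding center_def by blast

lemma one_center: "\<one> \<in> center G"
  by (rule centerI) auto

lemma center_mult_closed:
  assumes "z \<in> center G" "w \<in> center G"
  shows "z \<otimes> w \<in> center G"
proof -
  have zw: "z \<in> carrier G" "w \<in> carrier G" using assms by (auto intro: center_closed)
  have "z \<otimes> w \<otimes> g = g \<otimes> (z \<otimes> w)" if g: "g \<in> carrier G" for g
  proof -
    have "z \<otimes> w \<otimes> g = z \<otimes> g \<otimes> w"
      using zw g center_commute[OF assms(2) g] by (simp add: m_assoc)
    also have "\<dots> = g \<otimes> (z \<otimes> w)"
      using zw g center_commute[OF assms(1) g] by (simp add: m_assoc)
    finally show ?thesis .
  qed
  then show ?thesis using zw by (intro centerI) auto
qed

lemma commute_inv:
  assumes "x \<in> carrier G" "y \<in> carrier G" "x \<otimes> y = y \<otimes> x"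
  shows "inv x \<otimes> y = y \<otimes> inv x"
proof -
  have "inv x \<otimes> y = inv x \<otimes> (y \<otimes> x) \<otimes> inv x" using assms(1,2) by (simp add: m_assoc)
  also have "\<dots> = y \<otimes> inv x"
    using assms(1,2) by (simp add: assms(3)[symmetric] m_assoc[symmetric])
  finally show ?thesis .
qed

lemma normal_center: "center G \<lhd> G"
proof -
  have "inv z \<in> center G" if "z \<in> center G" for z
    using that by (intro centerI commute_inv) (auto intro: center_closed center_commute)
  then have sub: "subgroup (center G) G"
    by (intro subgroupI) (use one_center in \<open>auto intro: center_mult_closed center_closed\<close>)
  moreover have "x \<otimes> z \<otimes> inv x \<in> center G" if "x \<in> carrier G" "z \<in> center G" for x z
  proof -
    have "x \<otimes> z \<otimes> inv x = z"
      using that center_commute[OF that(2,1), symmetric] center_closed[OF that(2)]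
      by (simp add: m_assoc)
    with that(2) show ?thesis by simp
  qed
  ultimately show ?thesis by (simp add: normal_inv_iff)
qed

lemma list_prod_center: "set cs \<subseteq> center G \<Longrightarrow> list_prod G cs \<in> center G"
  by (induction cs) (auto intro: center_mult_closed one_center)

text \<open>If each tree of a forest evaluates to a central multiple of the image under \<open>f\<close> of its product,
  then all the central factors can be collected in front. With \<open>f\<close> the identity this serves
  grafting; with \<open>f\<close> a power of an automorphism it serves the twisted operation.\<close>
lemma list_prod_eval_list:
  assumes "f \<in> hom G G"
  shows "list_all2 (\<lambda>t c. c \<in> center G \<and>
      (\<forall>xs\<in>tuples (leaves t) (carrier G). eval q t xs = c \<otimes> f (list_prod G xs))) ts cs
    \<Longrightarrow> xs \<in> tuples (sum_list (map leaves ts)) (carrier G)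
    \<Longrightarrow> list_prod G (eval_list q ts xs) = list_prod G cs \<otimes> f (list_prod G xs)"
proof (induction ts cs arbitrary: xs rule: list_all2_induct)
  case Nil
  then show ?case using hom_one[OF assms group_axioms] by (simp add: tuples_def)
next
  case (Cons t ts c cs)
  define us vs where "us = take (leaves t) xs" and "vs = drop (leaves t) xs"
  have us: "us \<in> tuples (leaves t) (carrier G)"
    and vs: "vs \<in> tuples (sum_list (map leaves ts)) (carrier G)"
    using Cons(4) by (auto simp: us_def vs_def intro: tuples_take tuples_drop)
  then have sets: "set us \<subseteq> carrier G" "set vs \<subseteq> carrier G" by (auto simp: tuples_def)
  have f: "f x \<in> carrier G" if "x \<in> carrier G" for x using assms that by (auto simp: hom_def)
  have "set cs \<subseteq> center G"
    using Cons(2) by (auto simp: list_all2_conv_all_nth in_set_conv_nth)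
  then have P: "list_prod G cs \<in> center G" by (rule list_prod_center)
  have c: "c \<in> carrier G" using Cons(1) by (auto intro: center_closed)
  have "f (list_prod G xs) = f (list_prod G us \<otimes> list_prod G vs)"
    using list_prod_append[OF sets] by (simp add: us_def vs_def)
  also have "\<dots> = f (list_prod G us) \<otimes> f (list_prod G vs)"
    using assms sets by (simp add: hom_mult)
  finally have fxs: "f (list_prod G xs) = f (list_prod G us) \<otimes> f (list_prod G vs)" .
  have "list_prod G (eval_list q (t # ts) xs)
      = (c \<otimes> f (list_prod G us)) \<otimes> (list_prod G cs \<otimes> f (list_prod G vs))"
    using Cons(1) us Cons(3)[OF vs] by (simp add: us_def vs_def)
  also have "\<dots> = c \<otimes> (f (list_prod G us) \<otimes> list_prod G cs) \<otimes> f (list_prod G vs)"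
    using c f sets center_closed[OF P] by (simp add: m_assoc)
  also have "f (list_prod G us) \<otimes> list_prod G cs = list_prod G cs \<otimes> f (list_prod G us)"
    using center_commute[OF P] f sets by simp
  also have "c \<otimes> (list_prod G cs \<otimes> f (list_prod G us)) \<otimes> f (list_prod G vs)
      = list_prod G (c # cs) \<otimes> f (list_prod G xs)"
    using c f sets center_closed[OF P] by (simp add: m_assoc fxs)
  finally show ?case .
qed

end

lemma list_all2_replicate_same: "P a b \<Longrightarrow> list_all2 P (replicate n a) (replicate n b)"
  by (induction n) auto

section \<open>Trees that evaluate to a central multiple of the product\<close>

text \<open>The tree \<open>B\<close> acts as a caret of higher arity, whose operation is the product up to the central
  factor \<open>z\<close>. Three leaves leave one that is neither first nor last.\<close>
locale scaling_tree = group G for G (structure) +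
  fixes r :: nat and q :: "'a list \<Rightarrow> 'a" and B :: tree and z :: 'a
  assumes r_pos: "r \<ge> 1"
    and q_closed: "\<forall>xs\<in>tuples r (carrier G). q xs \<in> carrier G"
    and full_B: "full r B"
    and leaves_B: "leaves B \<ge> 3"
    and z_center: "z \<in> center G"
    and eval_B: "\<forall>xs\<in>tuples (leaves B) (carrier G). eval q B xs = z \<otimes> list_prod G xs"
begin

text \<open>The index counts the copies of \<open>B\<close> from which a tree is glued together. It determines both
  the number of leaves and the operation, so two trees with the same index form a pair in \<open>Assoc\<close>
  whatever their shapes.\<close>
definition scales :: "nat \<Rightarrow> tree \<Rightarrow> bool" where
  "scales n T \<longleftrightarrow> full r T \<and> leaves T = n * (leaves B - 1) + 1 \<and>
    (\<forall>xs\<in>tuples (leaves T) (carrier G). eval q T xs = z [^] n \<otimes> list_prod G xs)"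

lemma scales_Leaf: "scales 0 Leaf"
proof -
  have "eval q Leaf xs = list_prod G xs" if "xs \<in> tuples 1 (carrier G)" for xs
    using that by (cases xs) (auto simp: tuples_def)
  then show ?thesis by (auto simp: scales_def tuples_def)
qed

lemma pow_center: "z [^] (n :: nat) \<in> center G"
  by (induction n) (use z_center in \<open>auto intro: center_mult_closed one_center\<close>)

lemma scales_graft:
  assumes "list_all2 scales ns ts" "length ts = leaves B"
  shows "scales (Suc (sum_list ns)) (graft B ts)"
proof -
  have full: "\<forall>t\<in>set ts. full r t"
    using assms(1) by (auto simp: list_all2_conv_all_nth in_set_conv_nth scales_def)
  from assms(1) have "sum_list (map leaves ts) = sum_list ns * (leaves B - 1) + length ts"
    by (induction rule: list_all2_induct) (auto simp: scales_def add_mult_distrib)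
  then have leaves: "leaves (graft B ts) = Suc (sum_list ns) * (leaves B - 1) + 1"
    using assms(2) leaves_B by (simp add: leaves_graft(1))
  have "eval q (graft B ts) xs = z [^] Suc (sum_list ns) \<otimes> list_prod G xs"
    if "xs \<in> tuples (leaves (graft B ts)) (carrier G)" for xs
  proof -
    have xs: "xs \<in> tuples (sum_list (map leaves ts)) (carrier G)"
      using that assms(2) by (simp add: leaves_graft(1))
    then have len: "length xs = sum_list (map leaves ts)" and set: "set xs \<subseteq> carrier G"
      by (auto simp: tuples_def)
    have "list_all2 (\<lambda>t c. c \<in> center G \<and>
        (\<forall>xs\<in>tuples (leaves t) (carrier G). eval q t xs = c \<otimes> (\<lambda>x. x) (list_prod G xs)))
        ts (map (\<lambda>n. z [^] n) ns)"
      using assms(1) by (auto simp: list_all2_conv_all_nth scales_def pow_center)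
    then have "list_prod G (eval_list q ts xs) = z [^] sum_list ns \<otimes> list_prod G xs"
      using list_prod_eval_list[OF _ _ xs, of "\<lambda>x. x"] z_center
      by (simp add: list_prod_powers center_closed hom_def)
    moreover have "eval_list q ts xs \<in> tuples (leaves B) (carrier G)"
      using eval_closed(2)[OF q_closed full xs] assms(2) by simp
    ultimately have "eval q B (eval_list q ts xs) = z \<otimes> (z [^] sum_list ns \<otimes> list_prod G xs)"
      using eval_B by simp
    also have "\<dots> = z [^] Suc (sum_list ns) \<otimes> list_prod G xs"
      using nat_pow_Suc2[of z "sum_list ns"] center_closed[OF z_center] set
      by (simp add: m_assoc[symmetric])
    finally show ?thesis using eval_graft(1)[OF assms(2) len] by simp
  qed
  then show ?thesis
    using full_graft(1)[OF full_B assms(2) full] leaves by (simp add: scales_def)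
qed

lemma scales_left_comb: "scales n (left_comb B n)"
proof (induction n)
  case (Suc n)
  have "list_all2 scales (n # replicate (leaves B - 1) 0)
      (left_comb B n # replicate (leaves B - 1) Leaf)"
    using Suc scales_Leaf by (simp add: list_all2_replicate_same)
  from scales_graft[OF this] leaves_B show ?case by (simp add: sum_list_replicate)
qed (simp add: scales_Leaf)

lemma scales_right_comb: "scales n (right_comb B n)"
proof (induction n)
  case (Suc n)
  have "list_all2 scales (replicate (leaves B - 1) 0 @ [n])
      (replicate (leaves B - 1) Leaf @ [right_comb B n])"
    using Suc scales_Leaf by (intro list_all2_appendI) (simp_all add: list_all2_replicate_same)
  from scales_graft[OF this] leaves_B show ?case by (simp add: sum_list_replicate)
qed (simp add: scales_Leaf)

text \<open>The combs at the first and the last leaf of \<open>B\<close> determine the two outer depths; the comb at the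
  second leaf affects neither of them and serves to adjust the number of copies of \<open>B\<close>.\<close>
definition spread_tree :: "nat \<Rightarrow> nat \<Rightarrow> nat \<Rightarrow> tree" where
  "spread_tree m p n = graft B
     (left_comb B m # left_comb B p # replicate (leaves B - 3) Leaf @ [right_comb B n])"

lemma spread_tree:
  shows scales_spread_tree: "scales (Suc (m + p + n)) (spread_tree m p n)"
    and ldepth_spread_tree: "ldepth (spread_tree m p n) = Suc m * ldepth B"
    and rdepth_spread_tree: "rdepth (spread_tree m p n) = Suc n * rdepth B"
proof -
  let ?ts = "left_comb B m # left_comb B p # replicate (leaves B - 3) Leaf @ [right_comb B n]"
  have len: "length ?ts = leaves B" using leaves_B by simp
  have "list_all2 scales (m # p # replicate (leaves B - 3) 0 @ [n]) ?ts"
    by (simp add: scales_left_comb scales_right_comb scales_Leaf list_all2_replicate_same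
        list_all2_appendI)
  from scales_graft[OF this len] show "scales (Suc (m + p + n)) (spread_tree m p n)"
    by (simp add: spread_tree_def sum_list_replicate add.assoc)
  show "ldepth (spread_tree m p n) = Suc m * ldepth B"
    using ldepth_graft[OF r_pos full_B len] full_leaves_depth_left_comb[OF r_pos full_B]
    by (simp add: spread_tree_def)
  show "rdepth (spread_tree m p n) = Suc n * rdepth B"
    using rdepth_graft[OF r_pos full_B len] full_leaves_depth_right_comb[OF r_pos full_B]
    by (simp add: spread_tree_def)
qed

text \<open>The positive parts of \<open>i\<close> and \<open>j\<close> go into \<open>T\<close> and the negative parts into \<open>U\<close>. The comb at the inner
  leaf of either tree has the total length of the outer combs of the other one, so that both trees
  consist of equally many copies of \<open>B\<close>.\<close>
lemma depth_differences:
  fixes i j :: int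
  obtains T U where "(T, U) \<in> tree_pairs r"
    "\<forall>xs\<in>tuples (leaves T) (carrier G). eval q T xs = eval q U xs"
    "real (ldepth T) - real (ldepth U) = real (ldepth B) * of_int i"
    "real (rdepth T) - real (rdepth U) = real (rdepth B) * of_int j"
proof -
  define T where "T = spread_tree (nat i) (nat (- i) + nat (- j)) (nat j)"
  define U where "U = spread_tree (nat (- i)) (nat i + nat j) (nat (- j))"
  define n where "n = Suc (nat i + nat (- i) + nat j + nat (- j))"
  have "scales n T" "scales n U"
    using scales_spread_tree[of "nat i" "nat (- i) + nat (- j)" "nat j"]
      scales_spread_tree[of "nat (- i)" "nat i + nat j" "nat (- j)"]
    by (simp_all add: T_def U_def n_def ac_simps)
  then have "(T, U) \<in> tree_pairs r"
    "\<forall>xs\<in>tuples (leaves T) (carrier G). eval q T xs = eval q U xs"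
    by (auto simp: scales_def tree_pairs_def)
  moreover have sign: "real (nat l) - real (nat (- l)) = of_int l" for l by simp
  have "real (ldepth T) - real (ldepth U) = real (ldepth B) * (real (nat i) - real (nat (- i)))"
    by (simp add: T_def U_def ldepth_spread_tree algebra_simps)
  moreover have
    "real (rdepth T) - real (rdepth U) = real (rdepth B) * (real (nat j) - real (nat (- j)))"
    by (simp add: T_def U_def rdepth_spread_tree algebra_simps)
  ultimately show ?thesis unfolding sign by (rule that)
qed

end

text \<open>An injective map can be cancelled, so equal iterates yield an iterate that is the identity.\<close>
lemma iterates_eq_imp_dvd:
  assumes "\<phi> \<in> S \<rightarrow> S" "inj_on \<phi> S"
    and period: "\<And>n. \<forall>y\<in>S. (\<phi> ^^ n) y = y \<Longrightarrow> k dvd n"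
    and eq: "\<forall>y\<in>S. (\<phi> ^^ m) y = (\<phi> ^^ n) y"
  shows "int k dvd int m - int n"
proof -
  have closed: "(\<phi> ^^ i) y \<in> S" if "y \<in> S" for i y
    using assms(1) that by (induction i) auto
  have inj: "(\<phi> ^^ i) x = (\<phi> ^^ i) y \<Longrightarrow> x = y" if "x \<in> S" "y \<in> S" for i x y
  proof (induction i)
    case (Suc i)
    then show ?case using assms(2) closed that by (auto dest: inj_onD)
  qed simp
  have le: "k dvd j" if "\<forall>y\<in>S. (\<phi> ^^ (i + j)) y = (\<phi> ^^ i) y" for i j
  proof (intro period ballI)
    fix y assume "y \<in> S"
    with that have "(\<phi> ^^ i) ((\<phi> ^^ j) y) = (\<phi> ^^ i) y" by (simp add: funpow_add)
    with \<open>y \<in> S\<close> show "(\<phi> ^^ j) y = y" by (blast intro: inj closed)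
  qed
  show ?thesis
  proof (cases "m \<le> n")
    case True
    then have "k dvd n - m" using eq by (intro le[of m]) auto
    then have "int k dvd int n - int m" using True by (simp flip: of_nat_diff)
    then show ?thesis by (simp add: dvd_diff_commute)
  next
    case False
    then have "k dvd m - n" using eq by (intro le[of n]) auto
    then show ?thesis using False by (simp flip: of_nat_diff)
  qed
qed

lemma multiples_iff: "x \<in> multiples k \<longleftrightarrow> (\<exists>i::int. x = real k * of_int i)"
  by (auto simp: multiples_def Ints_def)

lemma multiples_1 [simp]: "multiples 1 = \<int>"
  by (auto simp: multiples_def)

context scaling_tree
begin

text \<open>The bounds meet as soon as the orders of the two twists are multiples of the outer depths
  of \<open>B\<close>.\<close>
lemma bdry_Assoc_eq:
  assumes "r \<ge> 2"
    and "left_twist r q \<phi>"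
    and left_period: "\<And>m n. \<forall>y\<in>carrier G. (\<phi> ^^ m) y = (\<phi> ^^ n) y
      \<Longrightarrow> int (ldepth B) dvd int m - int n"
    and "right_twist r q \<theta>"
    and right_period: "\<And>m n. \<forall>y\<in>carrier G. (\<theta> ^^ m) y = (\<theta> ^^ n) y
      \<Longrightarrow> int (rdepth B) dvd int m - int n"
  shows "bdry r ` Assoc r (carrier G) q = multiples (ldepth B) \<times> multiples (rdepth B)"
proof -
  have dvd_multiple: "real m - real n \<in> multiples k" if "int k dvd int m - int n" for k m n
  proof -
    from that obtain i where "int m - int n = int k * i" by (elim dvdE)
    then have "real_of_int (int m - int n) = real_of_int (int k * i)" by simp
    then show ?thesis by (auto simp: multiples_iff)
  qed
  show ?thesis
  proof (intro equalityI subsetI)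
    fix y assume "y \<in> bdry r ` Assoc r (carrier G) q"
    then obtain T U where TU: "(T, U) \<in> tree_pairs r"
        "\<forall>xs\<in>tuples (leaves T) (carrier G). eval q T xs = eval q U xs"
      and y: "y = (real (ldepth T) - real (ldepth U), real (rdepth T) - real (rdepth U))"
      unfolding bdry_Assoc[OF assms(1)] by blast
    from ldepth_iterates_eq[OF r_pos q_closed assms(2) TU] left_period
      rdepth_iterates_eq[OF r_pos q_closed assms(4) TU] right_period
    show "y \<in> multiples (ldepth B) \<times> multiples (rdepth B)"
      by (auto simp: y intro!: dvd_multiple)
  next
    fix y assume "y \<in> multiples (ldepth B) \<times> multiples (rdepth B)"
    then obtain a b where y: "y = (a, b)" and "a \<in> multiples (ldepth B)" "b \<in> multiples (rdepth B)"
      by blast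
    then obtain i j where ab: "a = real (ldepth B) * of_int i" "b = real (rdepth B) * of_int j"
      unfolding multiples_iff by blast
    obtain T U where TU: "(T, U) \<in> tree_pairs r"
      "\<forall>xs\<in>tuples (leaves T) (carrier G). eval q T xs = eval q U xs"
      "real (ldepth T) - real (ldepth U) = real (ldepth B) * of_int i"
      "real (rdepth T) - real (rdepth U) = real (rdepth B) * of_int j"
      using depth_differences[of i j] by blast
    have "y = (real (ldepth T) - real (ldepth U), real (rdepth T) - real (rdepth U))"
      by (simp only: y ab TU(3,4))
    with TU(1,2) show "y \<in> bdry r ` Assoc r (carrier G) q"
      unfolding bdry_Assoc[OF assms(1)] by blast
  qed
qed

end

section \<open>Conjugations and combs of carets\<close>

abbreviation caret :: "nat \<Rightarrow> tree" where
  "caret r \<equiv> Node (replicate r Leaf)"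

lemma full_leaves_depth_caret:
  assumes "r \<ge> 1"
  shows "full r (caret r)" "leaves (caret r) = r" "ldepth (caret r) = 1" "rdepth (caret r) = 1"
  using full_leaves_depth_complete_tree[OF assms, of 1] by auto

lemma eval_caret: "length xs = r \<Longrightarrow> eval q (caret r) xs = q xs"
  by (simp add: eval_list_Leaves)

context group
begin

definition conj_by :: "'a \<Rightarrow> 'a \<Rightarrow> 'a" where
  "conj_by a y = a \<otimes> y \<otimes> inv a"

lemma conj_by_closed: "a \<in> carrier G \<Longrightarrow> conj_by a \<in> carrier G \<rightarrow> carrier G"
  by (auto simp: conj_by_def)

lemma inj_conj_by: "a \<in> carrier G \<Longrightarrow> inj_on (conj_by a) (carrier G)"
  by (auto simp: conj_by_def inj_on_def)

lemma conj_by_mult: "a \<in> carrier G \<Longrightarrow> y \<in> carrier G \<Longrightarrow> conj_by a y \<otimes> a = a \<otimes> y"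
  by (simp add: conj_by_def m_assoc)

lemma mult_conj_by_inv: "b \<in> carrier G \<Longrightarrow> y \<in> carrier G \<Longrightarrow> b \<otimes> conj_by (inv b) y = y \<otimes> b"
  by (simp add: conj_by_def m_assoc[symmetric])

lemma conj_by_funpow:
  assumes "a \<in> carrier G" "y \<in> carrier G"
  shows "(conj_by a ^^ n) y = conj_by (a [^] n) y"
proof (induction n)
  case (Suc n)
  have "conj_by a (conj_by (a [^] n) y) = (a \<otimes> a [^] n) \<otimes> y \<otimes> inv (a \<otimes> a [^] n)"
    using assms by (simp add: conj_by_def m_assoc inv_mult_group)
  with Suc show ?case using assms nat_pow_Suc2[of a n] by (simp add: conj_by_def)
qed (use assms in \<open>simp add: conj_by_def\<close>)

text \<open>Powers of \<open>a\<close> are central exactly if the coset of \<open>a\<close> has the corresponding power 1, which links the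
  order in the quotient with the period of conjugation by \<open>a\<close>.\<close>
lemma pow_in_center_iff:
  assumes "a \<in> carrier G"
  shows "a [^] n \<in> center G \<longleftrightarrow> group.ord (G Mod center G) (center G #> a) dvd n"
proof -
  interpret center: normal "center G" G by (rule normal_center)
  interpret Q: group "G Mod center G" by (rule center.factorgroup_is_group)
  have "a [^] n \<in> center G \<longleftrightarrow> center G #> (a [^] n) = center G"
    using assms coset_join1[OF _ _ center.subgroup_axioms] coset_join2[OF _ center.subgroup_axioms]
    by blast
  also have "\<dots> \<longleftrightarrow> (center G #> a) [^]\<^bsub>G Mod center G\<^esub> n = \<one>\<^bsub>G Mod center G\<^esub>"
    using assms by (simp add: center.FactGroup_pow)
  also have "\<dots> \<longleftrightarrow> Q.ord (center G #> a) dvd n"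
    using assms by (intro Q.pow_eq_id) (auto simp: carrier_FactGroup)
  finally show ?thesis .
qed

lemma conj_by_pow_trivial_imp:
  assumes "a \<in> carrier G" "\<forall>y\<in>carrier G. (conj_by a ^^ n) y = y"
  shows "a [^] n \<in> center G"
proof (rule centerI)
  fix y assume y: "y \<in> carrier G"
  with assms have "conj_by (a [^] n) y = y" by (simp add: conj_by_funpow)
  then show "a [^] n \<otimes> y = y \<otimes> a [^] n"
    using conj_by_mult[of "a [^] n" y] assms(1) y by simp
qed (use assms in simp)

lemma order_mod_center_ge_2:
  assumes "a \<in> carrier G - center G" "k > 0"
    "group.ord (G Mod center G) (center G #> a) = k"
  shows "k \<ge> 2"
proof -
  have "k \<noteq> 1" using assms pow_in_center_iff[of a 1] by auto
  with assms(2) show ?thesis by simp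
qed

lemma conj_by_period:
  assumes "a \<in> carrier G" "\<And>n. a [^] n \<in> center G \<Longrightarrow> k dvd n"
    "\<forall>y\<in>carrier G. (conj_by a ^^ m) y = (conj_by a ^^ n) y"
  shows "int k dvd int m - int n"
  using assms(3)
  by (intro iterates_eq_imp_dvd[OF conj_by_closed inj_conj_by])
     (use assms(1,2) conj_by_pow_trivial_imp in auto)

lemma tuples_carrier_iff:
  "x # xs \<in> tuples n (carrier G) \<longleftrightarrow> n > 0 \<and> x \<in> carrier G \<and> xs \<in> tuples (n - 1) (carrier G)"
  by (auto simp: tuples_def)

text \<open>All internal vertices of a left comb lie on its leftmost branch, so every copy of \<open>a\<close> ends up in
  front of the first variable.\<close>
lemma eval_left_comb_caret:
  assumes "r \<ge> 1" "a \<in> carrier G"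
    and q: "\<forall>xs\<in>tuples r (carrier G). q xs = a \<otimes> list_prod G xs"
  shows "xs \<in> tuples (leaves (left_comb (caret r) n)) (carrier G) \<Longrightarrow>
    eval q (left_comb (caret r) n) xs = a [^] n \<otimes> list_prod G xs"
proof (induction n arbitrary: xs)
  case 0
  then show ?case by (cases xs) (auto simp: tuples_def)
next
  case (Suc n)
  define C where "C = left_comb (caret r) n"
  define us vs where "us = take (leaves C) xs" and "vs = drop (leaves C) xs"
  note caret = full_leaves_depth_caret[OF assms(1)]
  have comb: "left_comb (caret r) (Suc n) = graft (caret r) (C # replicate (r - 1) Leaf)"
    by (simp only: left_comb.simps caret C_def)
  have len: "length (C # replicate (r - 1) Leaf) = leaves (caret r)"
    using assms(1) by (simp add: sum_list_replicate)
  have "leaves (left_comb (caret r) (Suc n)) = leaves C + (r - 1)"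
    unfolding comb leaves_graft(1)[OF len] by (simp add: sum_list_replicate)
  with Suc(2) have "xs \<in> tuples (leaves C + (r - 1)) (carrier G)" by (simp only:)
  then have us: "us \<in> tuples (leaves C) (carrier G)" and vs: "vs \<in> tuples (r - 1) (carrier G)"
    and xs: "length xs = sum_list (map leaves (C # replicate (r - 1) Leaf))"
    by (auto simp: us_def vs_def sum_list_replicate tuples_def dest: in_set_takeD in_set_dropD)
  then have sets: "set us \<subseteq> carrier G" "set vs \<subseteq> carrier G" and lvs: "length vs = r - 1"
    by (auto simp: tuples_def)
  have IH: "eval q C us = a [^] n \<otimes> list_prod G us" using Suc(1) us by (simp add: C_def)
  have "eval q (left_comb (caret r) (Suc n)) xs = eval q (caret r) (eval q C us # vs)"
    unfolding comb eval_graft(1)[OF len xs] eval_list.simps us_def[symmetric] vs_def[symmetric]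
      eval_list_Leaves[OF lvs] ..
  also have "\<dots> = q (eval q C us # vs)"
    using lvs assms(1) by (intro eval_caret) simp
  also have "\<dots> = a \<otimes> (a [^] n \<otimes> list_prod G us \<otimes> list_prod G vs)"
    using q vs assms(1,2) sets by (simp add: IH tuples_carrier_iff)
  also have "\<dots> = a [^] Suc n \<otimes> list_prod G xs"
    using assms(2) sets list_prod_append[OF sets]
      nat_pow_Suc2[of a n]
    by (simp add: us_def vs_def m_assoc[symmetric])
  finally show ?case .
qed

lemma eval_right_comb_caret:
  assumes "r \<ge> 1" "b \<in> carrier G"
    and q: "\<forall>xs\<in>tuples r (carrier G). q xs = list_prod G xs \<otimes> b"
  shows "xs \<in> tuples (leaves (right_comb (caret r) n)) (carrier G) \<Longrightarrow>
    eval q (right_comb (caret r) n) xs = list_prod G xs \<otimes> b [^] n"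
proof (induction n arbitrary: xs)
  case 0
  then show ?case by (cases xs) (auto simp: tuples_def)
next
  case (Suc n)
  define C where "C = right_comb (caret r) n"
  define us vs where "us = take (r - 1) xs" and "vs = drop (r - 1) xs"
  note caret = full_leaves_depth_caret[OF assms(1)]
  have comb: "right_comb (caret r) (Suc n) = graft (caret r) (replicate (r - 1) Leaf @ [C])"
    by (simp only: right_comb.simps caret C_def)
  have len: "length (replicate (r - 1) Leaf @ [C]) = leaves (caret r)"
    using assms(1) by (simp add: sum_list_replicate)
  have "leaves (right_comb (caret r) (Suc n)) = r - 1 + leaves C"
    unfolding comb leaves_graft(1)[OF len] by (simp add: sum_list_replicate)
  with Suc(2) have "xs \<in> tuples (r - 1 + leaves C) (carrier G)" by (simp only:)
  then have us: "us \<in> tuples (r - 1) (carrier G)" and vs: "vs \<in> tuples (leaves C) (carrier G)"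
    and xs: "length xs = sum_list (map leaves (replicate (r - 1) Leaf @ [C]))"
    by (auto simp: us_def vs_def sum_list_replicate tuples_def dest: in_set_takeD in_set_dropD)
  then have sets: "set us \<subseteq> carrier G" "set vs \<subseteq> carrier G"
    and lus: "length us = r - 1" and lvs: "length vs = leaves C"
    by (auto simp: tuples_def)
  have IH: "eval q C vs = list_prod G vs \<otimes> b [^] n" using Suc(1) vs by (simp add: C_def)
  have "eval q (right_comb (caret r) (Suc n)) xs = eval q (caret r) (us @ [eval q C vs])"
  proof -
    have "eval_list q (replicate (r - 1) Leaf @ [C]) xs = us @ [eval q C vs]"
      using eval_list_Leaves[OF lus, of q] lvs
      by (simp add: eval_list_append sum_list_replicate us_def vs_def)
    then show ?thesis unfolding comb eval_graft(1)[OF len xs] by (simp only:)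
  qed
  also have "\<dots> = q (us @ [eval q C vs])"
    using lus assms(1) by (intro eval_caret) simp
  also have "\<dots> = list_prod G (us @ [eval q C vs]) \<otimes> b"
  proof -
    have "us @ [eval q C vs] \<in> tuples r (carrier G)"
      using lus sets assms(1,2) by (auto simp: tuples_def IH)
    with q show ?thesis by simp
  qed
  also have "\<dots> = list_prod G us \<otimes> (list_prod G vs \<otimes> b [^] n) \<otimes> b"
    using assms(2) sets by (subst list_prod_append) (auto simp: IH)
  also have "\<dots> = list_prod G xs \<otimes> b [^] Suc n"
    using assms(2) sets list_prod_append[OF sets] by (simp add: us_def vs_def m_assoc)
  finally show ?case .
qed

text \<open>All leaves have the same depth, so every variable is hit by the same power of \<open>\<psi>\<close>, while the
  constants stay central because \<open>\<psi>\<close> preserves the center.\<close>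
lemma eval_complete_tree:
  assumes "r \<ge> 1" "d \<in> center G" and \<psi>: "\<psi> \<in> hom G G" "\<psi> ` center G \<subseteq> center G"
    and q: "\<forall>xs\<in>tuples r (carrier G). q xs = d \<otimes> \<psi> (list_prod G xs)"
  shows "\<exists>z\<in>center G. \<forall>xs\<in>tuples (leaves (complete_tree r n)) (carrier G).
    eval q (complete_tree r n) xs = z \<otimes> (\<psi> ^^ n) (list_prod G xs)"
proof (induction n)
  case 0
  have "eval q Leaf xs = \<one> \<otimes> list_prod G xs" if "xs \<in> tuples 1 (carrier G)" for xs
    using that by (cases xs) (auto simp: tuples_def)
  then show ?case by (intro bexI[of _ "\<one>"]) (auto intro: one_center)
next
  case (Suc n)
  define P where "P = complete_tree r n"
  from Suc obtain z where z: "z \<in> center G"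
    "\<forall>xs\<in>tuples (leaves P) (carrier G). eval q P xs = z \<otimes> (\<psi> ^^ n) (list_prod G xs)"
    by (auto simp: P_def)
  have closed: "\<psi> x \<in> carrier G" if "x \<in> carrier G" for x using \<psi>(1) that by (auto simp: hom_def)
  have hom: "(\<psi> ^^ n) \<in> hom G G"
  proof (induction n)
    case (Suc n)
    then show ?case using \<psi>(1) by (auto simp: hom_def Pi_iff)
  qed (simp add: hom_def)
  define w where "w = list_prod G (replicate r z)"
  have w: "w \<in> center G" using z(1) by (auto simp: w_def intro!: list_prod_center)
  have full: "\<forall>t\<in>set (replicate r P). full r t"
    using full_leaves_depth_complete_tree[OF assms(1), of n] by (simp add: P_def)
  have q_closed: "\<forall>xs\<in>tuples r (carrier G). q xs \<in> carrier G"
    using q closed center_closed[OF assms(2)] by (auto simp: tuples_def)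
  have "eval q (complete_tree r (Suc n)) xs = d \<otimes> \<psi> w \<otimes> (\<psi> ^^ Suc n) (list_prod G xs)"
    if xs: "xs \<in> tuples (leaves (complete_tree r (Suc n))) (carrier G)" for xs
  proof -
    have xs': "xs \<in> tuples (sum_list (map leaves (replicate r P))) (carrier G)"
      using xs by (simp add: P_def)
    then have set: "set xs \<subseteq> carrier G" by (simp add: tuples_def)
    have ev: "eval_list q (replicate r P) xs \<in> tuples r (carrier G)"
      using eval_closed(2)[OF q_closed full xs'] by simp
    have "list_prod G (eval_list q (replicate r P) xs) = w \<otimes> (\<psi> ^^ n) (list_prod G xs)"
      unfolding w_def using z
      by (intro list_prod_eval_list[OF hom _ xs'] list_all2_replicate_same) auto
    then have "eval q (complete_tree r (Suc n)) xs = d \<otimes> \<psi> (w \<otimes> (\<psi> ^^ n) (list_prod G xs))"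
      using q ev by (simp add: P_def[symmetric])
    also have "\<psi> (w \<otimes> (\<psi> ^^ n) (list_prod G xs)) = \<psi> w \<otimes> \<psi> ((\<psi> ^^ n) (list_prod G xs))"
      using hom set center_closed[OF w] by (intro hom_mult[OF \<psi>(1)]) (auto simp: hom_def Pi_iff)
    finally show ?thesis
      using hom set center_closed[OF w] center_closed[OF assms(2)] closed
      by (simp add: m_assoc hom_def Pi_iff)
  qed
  moreover have "d \<otimes> \<psi> w \<in> center G" using w \<psi>(2) assms(2) by (auto intro: center_mult_closed)
  ultimately show ?case by blast
qed

end

text \<open>The last leaf of a left comb hangs on the root copy of \<open>B\<close>, whatever the length of the
  comb.\<close>
lemma rdepth_left_comb:
  assumes "r \<ge> 1" "full r B" "leaves B \<ge> 2"
  shows "rdepth (left_comb B (Suc n)) = rdepth B"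
  using rdepth_graft[OF assms(1,2), of "left_comb B n # replicate (leaves B - 1) Leaf"] assms(3)
  by simp

lemma ldepth_right_comb:
  assumes "r \<ge> 1" "full r B" "leaves B \<ge> 2"
  shows "ldepth (right_comb B (Suc n)) = ldepth B"
proof -
  have "replicate (leaves B - 1) Leaf \<noteq> []" using assms(3) by simp
  then show ?thesis
    using ldepth_graft[OF assms(1,2), of "replicate (leaves B - 1) Leaf @ [right_comb B n]"] assms(3)
    by (simp add: hd_append)
qed

section \<open>The three families of operations\<close>

context group
begin

text \<open>The left comb of \<open>k\<close> carets has the central factor \<open>a\<^sup>k\<close>. Its leftmost depth \<open>k\<close> is the order of
  conjugation by \<open>a\<close>, and its rightmost depth 1 matches the trivial twist on the right.\<close>
lemma bdry_Assoc_Left_Const: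
  assumes r: "r \<ge> 2" and op: "op_of_kind Left_Const r G k q"
  shows "bdry r ` Assoc r (carrier G) q = multiples k \<times> \<int>"
proof -
  from op obtain a where a: "a \<in> carrier G - center G" "k > 0"
    "group.ord (G Mod center G) (center G #> a) = k"
    and q: "\<forall>xs\<in>tuples r (carrier G). q xs = a \<otimes> list_prod G xs" by auto
  have k: "k \<ge> 2" using order_mod_center_ge_2[OF a] .
  have aG: "a \<in> carrier G" and r1: "r \<ge> 1" using a(1) r by auto
  have period: "a [^] n \<in> center G \<longleftrightarrow> k dvd n" for n
    using pow_in_center_iff[OF aG] a(3) by simp
  note caret = full_leaves_depth_caret[OF r1]
  define B where "B = left_comb (caret r) k"
  have B: "full r B" "leaves B = k * (r - 1) + 1" "ldepth B = k"
    using full_leaves_depth_left_comb[OF r1 caret(1), of k] by (simp_all only: B_def caret)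
  have rB: "rdepth B = 1"
    using rdepth_left_comb[OF r1 caret(1), of "k - 1"] k r by (simp only: B_def caret) simp
  \<comment> \<open>For \<open>r = 2\<close> the comb has \<open>k + 1\<close> leaves, so a third leaf exists only because the constant is
    not central.\<close>
  have "k * (r - 1) \<ge> 2 * 1" using k r by (intro mult_mono) auto
  then have leaves_B: "leaves B \<ge> 3" by (simp only: B(2))
  interpret scaling_tree G r q B "a [^] k"
  proof
    show "\<forall>xs\<in>tuples r (carrier G). q xs \<in> carrier G"
      using q aG by (auto simp: tuples_def)
    show "\<forall>xs\<in>tuples (leaves B) (carrier G). eval q B xs = a [^] k \<otimes> list_prod G xs"
      using eval_left_comb_caret[OF r1 aG q, of _ k] unfolding B_def by blast
  qed (use r1 B(1) leaves_B period in auto)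
  have left: "left_twist r q (conj_by a)"
    unfolding left_twist_def
  proof (intro conjI ballI allI impI)
    fix y c cs assume y: "y \<in> carrier G" and cs: "c # cs \<in> tuples r (carrier G)"
    then have "c \<in> carrier G" "set cs \<subseteq> carrier G" "(y \<otimes> c) # cs \<in> tuples r (carrier G)"
      by (auto simp: tuples_def)
    with q cs y aG show "q ((y \<otimes> c) # cs) = conj_by a y \<otimes> q (c # cs)"
      using conj_by_mult[OF aG y] funcset_mem[OF conj_by_closed[OF aG] y]
      by (simp add: m_assoc[symmetric])
  qed (rule conj_by_closed[OF aG])
  have right: "right_twist r q (\<lambda>y. y)"
    unfolding right_twist_def
  proof (intro conjI ballI allI impI)
    fix y c cs assume y: "y \<in> carrier G" and cs: "cs @ [c] \<in> tuples r (carrier G)"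
    then have "c \<in> carrier G" "set cs \<subseteq> carrier G" "cs @ [c \<otimes> y] \<in> tuples r (carrier G)"
      by (auto simp: tuples_def)
    with q cs y aG show "q (cs @ [c \<otimes> y]) = q (cs @ [c]) \<otimes> y"
      by (simp add: list_prod_append m_assoc)
  qed simp
  have "bdry r ` Assoc r (carrier G) q = multiples (ldepth B) \<times> multiples (rdepth B)"
    using period by (intro bdry_Assoc_eq[OF r left _ right])
      (auto simp: rB B(3) intro: conj_by_period[OF aG])
  then show ?thesis by (simp only: B(3) rB multiples_1)
qed

text \<open>The mirror image: the right comb of \<open>k\<close> carets has the central factor \<open>b\<^sup>k\<close>. A factor behind
  the last argument has to pass \<open>b\<close>, which conjugates it by the inverse of \<open>b\<close>.\<close>
lemma bdry_Assoc_Right_Const: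
  assumes r: "r \<ge> 2" and op: "op_of_kind Right_Const r G k q"
  shows "bdry r ` Assoc r (carrier G) q = \<int> \<times> multiples k"
proof -
  from op obtain b where b: "b \<in> carrier G - center G" "k > 0"
    "group.ord (G Mod center G) (center G #> b) = k"
    and q: "\<forall>xs\<in>tuples r (carrier G). q xs = list_prod G xs \<otimes> b" by auto
  have k: "k \<ge> 2" using order_mod_center_ge_2[OF b] .
  have bG: "b \<in> carrier G" and r1: "r \<ge> 1" using b(1) r by auto
  have period: "b [^] n \<in> center G \<longleftrightarrow> k dvd n" for n
    using pow_in_center_iff[OF bG] b(3) by simp
  have inv_period: "k dvd n" if "inv b [^] n \<in> center G" for n
  proof -
    have "inv (inv b [^] n) \<in> center G"
      using that normal_imp_subgroup[OF normal_center] by (rule subgroup.m_inv_closed[rotated])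
    with bG period show ?thesis by (simp add: nat_pow_inv)
  qed
  note caret = full_leaves_depth_caret[OF r1]
  define B where "B = right_comb (caret r) k"
  have B: "full r B" "leaves B = k * (r - 1) + 1" "rdepth B = k"
    using full_leaves_depth_right_comb[OF r1 caret(1), of k] by (simp_all only: B_def caret)
  have lB: "ldepth B = 1"
    using ldepth_right_comb[OF r1 caret(1), of "k - 1"] k r by (simp only: B_def caret) simp
  \<comment> \<open>For \<open>r = 2\<close> the comb has \<open>k + 1\<close> leaves, so a third leaf exists only because the constant is
    not central.\<close>
  have "k * (r - 1) \<ge> 2 * 1" using k r by (intro mult_mono) auto
  then have leaves_B: "leaves B \<ge> 3" by (simp only: B(2))
  have bk: "b [^] k \<in> center G" using period by simp
  interpret scaling_tree G r q B "b [^] k"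
  proof
    show "\<forall>xs\<in>tuples r (carrier G). q xs \<in> carrier G"
      using q bG by (auto simp: tuples_def)
    show "\<forall>xs\<in>tuples (leaves B) (carrier G). eval q B xs = b [^] k \<otimes> list_prod G xs"
      using eval_right_comb_caret[OF r1 bG q, of _ k] center_commute[OF bk] unfolding B_def
      by (auto simp: tuples_def)
  qed (use r1 B(1) leaves_B bk in auto)
  have left: "left_twist r q (\<lambda>y. y)"
    unfolding left_twist_def
  proof (intro conjI ballI allI impI)
    fix y c cs assume y: "y \<in> carrier G" and cs: "c # cs \<in> tuples r (carrier G)"
    then have "c \<in> carrier G" "set cs \<subseteq> carrier G" "(y \<otimes> c) # cs \<in> tuples r (carrier G)"
      by (auto simp: tuples_def)
    with q cs y bG show "q ((y \<otimes> c) # cs) = y \<otimes> q (c # cs)"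
      by (simp add: m_assoc)
  qed simp
  have right: "right_twist r q (conj_by (inv b))"
    unfolding right_twist_def
  proof (intro conjI ballI allI impI)
    fix y c cs assume y: "y \<in> carrier G" and cs: "cs @ [c] \<in> tuples r (carrier G)"
    then have "c \<in> carrier G" "set cs \<subseteq> carrier G" "cs @ [c \<otimes> y] \<in> tuples r (carrier G)"
      by (auto simp: tuples_def)
    with q cs y bG show "q (cs @ [c \<otimes> y]) = q (cs @ [c]) \<otimes> conj_by (inv b) y"
      using mult_conj_by_inv[OF bG y] funcset_mem[OF conj_by_closed[OF inv_closed[OF bG]] y]
      by (simp add: list_prod_append m_assoc)
  qed (rule conj_by_closed[OF inv_closed[OF bG]])
  have "bdry r ` Assoc r (carrier G) q = multiples (ldepth B) \<times> multiples (rdepth B)"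
    using inv_period by (intro bdry_Assoc_eq[OF r left _ right])
      (auto simp: lB B(3) intro: conj_by_period[OF inv_closed[OF bG]])
  then show ?thesis by (simp only: B(3) lB multiples_1)
qed

lemma AutoGroup_carrierD:
  assumes "\<psi> \<in> carrier (AutoGroup G)"
  shows "\<psi> \<in> hom G G" "bij_betw \<psi> (carrier G) (carrier G)" "\<psi> \<in> extensional (carrier G)"
  using assms by (auto simp: AutoGroup_def auto_def Bij_def)

text \<open>Powers in \<open>AutoGroup G\<close> are extensional, so they agree with function iteration on the carrier
  only.\<close>
lemma AutoGroup_pow_apply:
  assumes "\<psi> \<in> carrier (AutoGroup G)" "x \<in> carrier G"
  shows "(\<psi> [^]\<^bsub>AutoGroup G\<^esub> n) x = (\<psi> ^^ n) x"
proof -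
  interpret A: group "AutoGroup G" by (rule AutoGroup)
  have Bij: "\<phi> \<in> Bij (carrier G)" if "\<phi> \<in> carrier (AutoGroup G)" for \<phi>
    using that by (auto simp: AutoGroup_def auto_def)
  show ?thesis using assms(2)
  proof (induction n arbitrary: x)
    case 0
    then show ?case by (simp add: AutoGroup_def BijGroup_def)
  next
    case (Suc n)
    have "(\<psi> [^]\<^bsub>AutoGroup G\<^esub> Suc n) x = compose (carrier G) (\<psi> [^]\<^bsub>AutoGroup G\<^esub> n) \<psi> x"
      using Bij[OF assms(1)] Bij[OF A.nat_pow_closed[OF assms(1)]]
      by (simp add: AutoGroup_def BijGroup_def)
    also have "\<dots> = (\<psi> [^]\<^bsub>AutoGroup G\<^esub> n) (\<psi> x)" using Suc(2) by (simp add: compose_def)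
    also have "\<dots> = (\<psi> ^^ n) (\<psi> x)"
      using Suc AutoGroup_carrierD(2)[OF assms(1)] by (auto dest: bij_betwE)
    finally show ?case by (simp add: funpow_swap1)
  qed
qed

lemma AutoGroup_ord_dvd_iff:
  assumes "\<psi> \<in> carrier (AutoGroup G)"
  shows "(\<forall>x\<in>carrier G. (\<psi> ^^ n) x = x) \<longleftrightarrow> group.ord (AutoGroup G) \<psi> dvd n"
proof -
  interpret A: group "AutoGroup G" by (rule AutoGroup)
  have one: "\<one>\<^bsub>AutoGroup G\<^esub> x = x" if "x \<in> carrier G" for x
    using that by (simp add: AutoGroup_def BijGroup_def)
  have "\<psi> [^]\<^bsub>AutoGroup G\<^esub> n = \<one>\<^bsub>AutoGroup G\<^esub> \<longleftrightarrow> (\<forall>x\<in>carrier G. (\<psi> ^^ n) x = x)"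
  proof
    assume "\<forall>x\<in>carrier G. (\<psi> ^^ n) x = x"
    then show "\<psi> [^]\<^bsub>AutoGroup G\<^esub> n = \<one>\<^bsub>AutoGroup G\<^esub>"
      using AutoGroup_carrierD(3)[OF A.nat_pow_closed[OF assms]] AutoGroup_carrierD(3)[OF A.one_closed]
      by (intro extensionalityI[where A = "carrier G"]) (auto simp: AutoGroup_pow_apply[OF assms] one)
  qed (metis AutoGroup_pow_apply[OF assms] one)
  with A.pow_eq_id[OF assms] show ?thesis by simp
qed

lemma automorphism_center:
  assumes "\<psi> \<in> hom G G" "\<psi> ` carrier G = carrier G"
  shows "\<psi> ` center G \<subseteq> center G"
proof (clarify, rule centerI)
  fix z assume z: "z \<in> center G"
  note zG = center_closed[OF z]
  show "\<psi> z \<in> carrier G" using assms zG by auto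
  fix g assume "g \<in> carrier G"
  then obtain g' where g': "g' \<in> carrier G" "g = \<psi> g'" using assms(2) by auto
  then show "\<psi> z \<otimes> g = g \<otimes> \<psi> z"
    using hom_mult[OF assms(1) zG g'(1)] hom_mult[OF assms(1) g'(1) zG] center_commute[OF z g'(1)]
    by simp
qed

text \<open>The complete tree of height \<open>h\<close> applies \<open>\<psi>\<^sup>h\<close>, the identity, to every variable. It has \<open>r\<^sup>h\<close> leaves,
  which is at least 4.\<close>
lemma bdry_Assoc_Twisted:
  assumes r: "r \<ge> 2" and op: "op_of_kind Twisted r G h q"
  shows "h \<ge> 2" "bdry r ` Assoc r (carrier G) q = multiples h \<times> multiples h"
proof -
  from op obtain d \<psi> where d: "d \<in> center G" and \<psi>: "\<psi> \<in> carrier (AutoGroup G)"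
    "\<psi> \<noteq> \<one>\<^bsub>AutoGroup G\<^esub>" "h > 0" "group.ord (AutoGroup G) \<psi> = h"
    and q: "\<forall>xs\<in>tuples r (carrier G). q xs = d \<otimes> \<psi> (list_prod G xs)" by auto
  note aut = AutoGroup_carrierD[OF \<psi>(1)]
  have period: "(\<forall>x\<in>carrier G. (\<psi> ^^ n) x = x) \<longleftrightarrow> h dvd n" for n
    using AutoGroup_ord_dvd_iff[OF \<psi>(1)] \<psi>(4) by simp
  have "h \<noteq> 1" using group.ord_eq_1[OF AutoGroup \<psi>(1)] \<psi>(2,4) by simp
  with \<psi>(3) show h: "h \<ge> 2" by simp
  have r1: "r \<ge> 1" using r by simp
  have dG: "d \<in> carrier G" using center_closed[OF d] .
  have \<psi>G: "\<psi> \<in> carrier G \<rightarrow> carrier G" "inj_on \<psi> (carrier G)" "\<psi> ` carrier G = carrier G"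
    using aut(2) by (auto simp: bij_betw_def)
  note \<psi>_closed = funcset_mem[OF \<psi>G(1)]
  define B where "B = complete_tree r h"
  have B: "full r B" "leaves B = r ^ h" "ldepth B = h" "rdepth B = h"
    using full_leaves_depth_complete_tree[OF r1, of h] by (simp_all add: B_def)
  have "(2::nat) ^ 2 \<le> 2 ^ h" using h by (intro power_increasing) auto
  also have "\<dots> \<le> r ^ h" using r by (intro power_mono) auto
  finally have leaves_B: "leaves B \<ge> 3" by (simp add: B(2))
  obtain z where z: "z \<in> center G"
    "\<forall>xs\<in>tuples (leaves B) (carrier G). eval q B xs = z \<otimes> (\<psi> ^^ h) (list_prod G xs)"
    using eval_complete_tree[OF r1 d aut(1) automorphism_center[OF aut(1) \<psi>G(3)] q, of h]
    unfolding B_def by blast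
  interpret scaling_tree G r q B z
  proof
    show "\<forall>xs\<in>tuples r (carrier G). q xs \<in> carrier G"
      using q dG \<psi>_closed by (auto simp: tuples_def)
    show "\<forall>xs\<in>tuples (leaves B) (carrier G). eval q B xs = z \<otimes> list_prod G xs"
      using z(2) period[of h] by (simp add: tuples_def)
  qed (use r1 B(1) leaves_B z(1) in auto)
  have left: "left_twist r q \<psi>"
    unfolding left_twist_def
  proof (intro conjI ballI allI impI)
    fix y c cs assume y: "y \<in> carrier G" and cs: "c # cs \<in> tuples r (carrier G)"
    then have ccs: "c \<in> carrier G" "set cs \<subseteq> carrier G" "(y \<otimes> c) # cs \<in> tuples r (carrier G)"
      by (auto simp: tuples_def)
    define p where "p = list_prod G (c # cs)"
    have p: "p \<in> carrier G" using ccs by (simp add: p_def)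
    have "q ((y \<otimes> c) # cs) = d \<otimes> \<psi> (y \<otimes> p)"
      using q[rule_format, OF ccs(3)] ccs y by (simp add: p_def m_assoc)
    also have "\<dots> = d \<otimes> \<psi> y \<otimes> \<psi> p"
      using y p dG \<psi>_closed by (simp add: hom_mult[OF aut(1)] m_assoc)
    also have "d \<otimes> \<psi> y = \<psi> y \<otimes> d" using center_commute[OF d \<psi>_closed[OF y]] .
    also have "\<psi> y \<otimes> d \<otimes> \<psi> p = \<psi> y \<otimes> q (c # cs)"
      using q[rule_format, OF cs] y p dG \<psi>_closed by (simp only: p_def m_assoc)
    finally show "q ((y \<otimes> c) # cs) = \<psi> y \<otimes> q (c # cs)" .
  qed (rule \<psi>G(1))
  have right: "right_twist r q \<psi>"
    unfolding right_twist_def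
  proof (intro conjI ballI allI impI)
    fix y c cs assume y: "y \<in> carrier G" and cs: "cs @ [c] \<in> tuples r (carrier G)"
    then have ccs: "c \<in> carrier G" "set cs \<subseteq> carrier G" "cs @ [c \<otimes> y] \<in> tuples r (carrier G)"
      by (auto simp: tuples_def)
    define p where "p = list_prod G (cs @ [c])"
    have p: "p \<in> carrier G" using ccs by (simp add: p_def)
    have "q (cs @ [c \<otimes> y]) = d \<otimes> \<psi> (p \<otimes> y)"
      using q[rule_format, OF ccs(3)] ccs y by (simp add: p_def m_assoc list_prod_append)
    also have "\<dots> = d \<otimes> \<psi> p \<otimes> \<psi> y"
      using y p dG \<psi>_closed by (simp add: hom_mult[OF aut(1)] m_assoc)
    also have "\<dots> = q (cs @ [c]) \<otimes> \<psi> y"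
      using q[rule_format, OF cs] by (simp only: p_def)
    finally show "q (cs @ [c \<otimes> y]) = q (cs @ [c]) \<otimes> \<psi> y" .
  qed (rule \<psi>G(1))
  have dvd: "int h dvd int m - int n" if "\<forall>y\<in>carrier G. (\<psi> ^^ m) y = (\<psi> ^^ n) y" for m n
    using that period by (intro iterates_eq_imp_dvd[OF \<psi>G(1,2)]) auto
  have "bdry r ` Assoc r (carrier G) q = multiples (ldepth B) \<times> multiples (rdepth B)"
    using dvd by (intro bdry_Assoc_eq[OF r left _ right]) (auto simp: B(3,4))
  then show "bdry r ` Assoc r (carrier G) q = multiples h \<times> multiples h" by (simp only: B(3,4))
qed

lemma op_of_kind_order_ge_2:
  assumes "r \<ge> 2" "op_of_kind c r G k q"
  shows "k \<ge> 2"
proof (cases c)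
  case Left_Const
  with assms(2) show ?thesis by (auto intro: order_mod_center_ge_2)
next
  case Right_Const
  with assms(2) show ?thesis by (auto intro: order_mod_center_ge_2)
next
  case Twisted
  with assms show ?thesis using bdry_Assoc_Twisted(1) by simp
qed

end

section \<open>Recovering the kind and the order\<close>

fun bdry_image :: "op_kind \<Rightarrow> nat \<Rightarrow> (real \<times> real) set" where
  "bdry_image Left_Const k = multiples k \<times> \<int>"
| "bdry_image Right_Const k = \<int> \<times> multiples k"
| "bdry_image Twisted k = multiples k \<times> multiples k"

lemma (in group) bdry_Assoc_of_kind:
  assumes "r \<ge> 2" "op_of_kind c r G k q"
  shows "bdry r ` Assoc r (carrier G) q = bdry_image c k"
  using assms bdry_Assoc_Left_Const bdry_Assoc_Right_Const bdry_Assoc_Twisted(2) by (cases c) auto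

lemma of_nat_in_multiples_iff: "real n \<in> multiples k \<longleftrightarrow> k dvd n"
proof
  assume "real n \<in> multiples k"
  then obtain i :: int where "real n = real k * of_int i" by (auto simp: multiples_iff)
  then have "real_of_int (int n) = real_of_int (int k * i)" by simp
  then have "int n = int k * i" by (simp only: of_int_eq_iff)
  then have "int k dvd int n" by simp
  then show "k dvd n" by simp
next
  assume "k dvd n"
  then obtain i where "n = k * i" by blast
  then have "real n = real k * of_int (int i)" by simp
  then show "real n \<in> multiples k" unfolding multiples_iff by blast
qed

text \<open>Divisibility of 1 tells the kinds apart: \<open>(1, 0)\<close> and \<open>(0, 1)\<close> test the two coordinates. The diagonal
  then recovers the order, whichever coordinate carries it.\<close>
lemma bdry_image_inject:
  assumes "k \<ge> 2" "k' \<ge> 2" "bdry_image c k = bdry_image c' k'"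
  shows "c = c' \<and> k = k'"
proof -
  have mem: "(real m, real n) \<in> bdry_image c k \<longleftrightarrow>
      (c \<noteq> Right_Const \<longrightarrow> k dvd m) \<and> (c \<noteq> Left_Const \<longrightarrow> k dvd n)" for c k m n
    by (cases c) (auto simp: of_nat_in_multiples_iff)
  have eq: "(c \<noteq> Right_Const \<longrightarrow> k dvd m) \<and> (c \<noteq> Left_Const \<longrightarrow> k dvd n) \<longleftrightarrow>
      (c' \<noteq> Right_Const \<longrightarrow> k' dvd m) \<and> (c' \<noteq> Left_Const \<longrightarrow> k' dvd n)" for m n
    unfolding mem[symmetric] assms(3) ..
  have "\<not> k dvd 1" "\<not> k' dvd 1" using assms(1,2) by auto
  then have c: "c = c'"
    using eq[of 1 0] eq[of 0 1] by (cases c; cases c') auto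
  have "k dvd m \<longleftrightarrow> k' dvd m" for m
    using eq[of m m] unfolding c by (cases c') auto
  then have "k = k'" by (meson dvd_antisym dvd_refl)
  with c show ?thesis by simp
qed

theorem corollary5p12:
  fixes r :: nat
    and G :: "('a, 'm) monoid_scheme"
    and H :: "('b, 'n) monoid_scheme"
  assumes "r \<ge> 2" and "group G" and "group H"
  shows "(\<forall>\<omega> k. op_of_kind Left_Const r G k \<omega> \<longrightarrow>
            bdry r ` Assoc r (carrier G) \<omega> = multiples k \<times> \<int>) \<and>
         (\<forall>\<omega> k. op_of_kind Right_Const r G k \<omega> \<longrightarrow>
            bdry r ` Assoc r (carrier G) \<omega> = \<int> \<times> multiples k) \<and>
         (\<forall>\<omega> h. op_of_kind Twisted r G h \<omega> \<longrightarrow>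
            bdry r ` Assoc r (carrier G) \<omega> = multiples h \<times> multiples h) \<and>
         (\<forall>c c' k k' \<omega> \<omega>'.
            op_of_kind c r G k \<omega> \<longrightarrow> op_of_kind c' r H k' \<omega>' \<longrightarrow>
            bdry r ` Assoc r (carrier G) \<omega> = bdry r ` Assoc r (carrier H) \<omega>' \<longrightarrow>
            c = c' \<and> k = k')"
proof -
  interpret G: group G by fact
  interpret H: group H by fact
  have "c = c' \<and> k = k'"
    if "op_of_kind c r G k \<omega>" "op_of_kind c' r H k' \<omega>'"
      "bdry r ` Assoc r (carrier G) \<omega> = bdry r ` Assoc r (carrier H) \<omega>'" for c c' k k' \<omega> \<omega>'
  proof (rule bdry_image_inject)
    show "k \<ge> 2" "k' \<ge> 2"
      using G.op_of_kind_order_ge_2[OF assms(1) that(1)] H.op_of_kind_order_ge_2[OF assms(1) that(2)] .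
    show "bdry_image c k = bdry_image c' k'"
      using that G.bdry_Assoc_of_kind[OF assms(1)] H.bdry_Assoc_of_kind[OF assms(1)] by metis
  qed
  then show ?thesis
    using G.bdry_Assoc_Left_Const[OF assms(1)] G.bdry_Assoc_Right_Const[OF assms(1)]
      G.bdry_Assoc_Twisted(2)[OF assms(1)] by blast
qed

end
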